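(* Let $a_1,a_2\ge 0$ with $a_1+a_2=\tfrac12$. For each integer $d\ge 2$ let $A,B,C$ be qubits, let $A'=B'=\mathbb{C}^d$, $C'=\mathbb{C}^2$, and define the density operator on $ABCA'B'C'$ $$\rho_d=a_1|\psi_0\rangle\langle\psi_0|\otimes\rho_s\otimes|0\rangle\langle 0|+a_1|\psi_1\rangle\langle\psi_1|\otimes\rho_a\otimes|0\rangle\langle 0|+a_2|\psi_2\rangle\langle\psi_2|\otimes\rho_a\otimes|1\rangle\langle 1|+a_2|\psi_3\rangle\langle\psi_3|\otimes\rho_s\otimes|1\rangle\langle 1|,$$ where, on $ABC$, $$|\psi_0\rangle=\tfrac12(|000\rangle+|011\rangle+|101\rangle+|110\rangle),\quad |\psi_1\rangle=\tfrac12(|000\rangle+|011\rangle-|101\rangle-|110\rangle),$$ $$|\psi_2\rangle=\tfrac12(|000\rangle-|011\rangle+|101\rangle-|110\rangle),\quad |\psi_3\rangle=\tfrac12(|000\rangle-|011\rangle-|101\rangle+|110\rangle),$$ and, on $A'B'$, $$\rho_s=\frac{\mathcal{I}+\mathcal{F}}{d^2+d},\qquad \rho_a=\frac{\mathcal{I}-\mathcal{F}}{d^2-d},$$ with $\mathcal{I}$ the identity on $\mathbb{C}^d\otimes\mathbb{C}^d$ and $\mathcal{F}=\sum_{i,j=0}^{d-1}|ij\rangle\langle ji|$ the flip operator; the factors $|0\rangle\langle0|,|1\rangle\langle1|$ act on $C'$. Then for every $d\ge2$ the state $\rho_d$ is a 3-party secret-sharing state, and its bipartite distillable entanglement for the split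 $AA'$-$BB'CC'$ tends to $0$ as $d\to\infty$. In particular, for every $\varepsilon>0$ there is a 3-party secret-sharing state whose bipartite distillable entanglement for the split $AA'$-$BB'CC'$ is less than $\varepsilon$.
   Context: A density operator on $ABCA'B'C'$ ($A,B,C$ qubits) is a *(3-party) secret-sharing state* if it is of the form $$\frac14\sum_{\substack{i+j+k\equiv 0\ (\mathrm{mod}\ 2)\\ i'+j'+k'\equiv 0\ (\mathrm{mod}\ 2)}} |ijk\rangle\langle i'j'k'|_{ABC}\otimes U_{ijk}\,\rho_{A'B'C'}\,U_{i'j'k'}^{\dagger}$$ for some density operator $\rho_{A'B'C'}$ on $A'B'C'$ and some unitary operators $U_{ijk}$ on $A'B'C'$ (one for each $(i,j,k)\in\{0,1\}^3$ with $i+j+k$ even), the sum being over $i,j,k,i',j',k'\in\{0,1\}$ satisfying the parity conditions. The bipartite distillable entanglement for the split $AA'$-$BB'CC'$ is the usual distillable entanglement of the state viewed as a bipartite state between a laboratory holding $AA'$ and a laboratory holding $BB'CC'$: the supremum of the asymptotic rates at which copies of the two-qubit maximally entangled state $\frac1{\sqrt2}(|00\rangle+|11\rangle)$ can be obtained, with error tending to $0$, per copy of the given state by local operations and classical communication (LOCC) between the two laboratories. *)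

theory Defs
  imports
    "HOL-Library.Extended_Real"
    "Jordan_Normal_Form.Schur_Decomposition"
begin

section \<open>Operators on finite-dimensional Hilbert spaces\<close>

definition mat_trace :: "'a::comm_monoid_add mat \<Rightarrow> 'a" where
  "mat_trace M = (\<Sum>i<dim_row M. M $$ (i, i))"

definition density_operator :: "nat \<Rightarrow> complex mat \<Rightarrow> bool" where
  "density_operator n \<rho> \<longleftrightarrow>
     \<rho> \<in> carrier_mat n n \<and> (\<forall>v\<in>carrier_vec n. 0 \<le> (\<rho> *\<^sub>v v) \<bullet>c v) \<and> mat_trace \<rho> = 1"

definition unitary_operator :: "nat \<Rightarrow> complex mat \<Rightarrow> bool" where
  "unitary_operator n U \<longleftrightarrow>
     U \<in> carrier_mat n n \<and> U * mat_adjoint U = 1\<^sub>m n \<and> mat_adjoint U * U = 1\<^sub>m n"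

text \<open>Type \<^typ>\<open>'a mat\<close> has no zero of variable size, so sums of matrices carry their
  dimensions \<open>r\<close> and \<open>c\<close>.\<close>

definition mat_setsum :: "nat \<Rightarrow> nat \<Rightarrow> ('k \<Rightarrow> 'a::comm_monoid_add mat) \<Rightarrow> 'k set \<Rightarrow> 'a mat" where
  "mat_setsum r c f S = mat r c (\<lambda>(i, j). \<Sum>k\<in>S. f k $$ (i, j))"

definition outer :: "complex vec \<Rightarrow> complex vec \<Rightarrow> complex mat" where
  "outer u v = mat (dim_vec u) (dim_vec v) (\<lambda>(i, j). u $ i * conjugate (v $ j))"

definition kron :: "'a::semiring_0 mat \<Rightarrow> 'a mat \<Rightarrow> 'a mat" (infixr \<open>\<otimes>\<^sub>m\<close> 72) where
  "M \<otimes>\<^sub>m N = mat (dim_row M * dim_row N) (dim_col M * dim_col N)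
     (\<lambda>(i, j). M $$ (i div dim_row N, j div dim_col N) * N $$ (i mod dim_row N, j mod dim_col N))"


section \<open>Multipartite systems\<close>

text \<open>A system with subsystem dimensions \<open>[d\<^sub>1, \<dots>, d\<^sub>k]\<close> is \<open>\<complex>\<^bsup>d\<^sub>1 \<cdots> d\<^sub>k\<^esup>\<close>, the basis vector
  \<open>|x\<^sub>1 \<dots> x\<^sub>k\<rangle>\<close> having the index with mixed-radix digits \<open>x\<^sub>1, \<dots>, x\<^sub>k\<close>, most significant
  first; this is the convention of \<^const>\<open>kron\<close>.\<close>

fun index_of :: "nat list \<Rightarrow> nat list \<Rightarrow> nat" where
  "index_of (d # ds) (x # xs) = x * prod_list ds + index_of ds xs"
| "index_of _ _ = 0"

fun digits_of :: "nat list \<Rightarrow> nat \<Rightarrow> nat list" where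
  "digits_of [] r = []"
| "digits_of (d # ds) r = (r div prod_list ds) # digits_of ds (r mod prod_list ds)"

definition ket :: "nat list \<Rightarrow> nat list \<Rightarrow> complex vec" where
  "ket ds xs = unit_vec (prod_list ds) (index_of ds xs)"

abbreviation ket3 :: "nat \<Rightarrow> nat \<Rightarrow> nat \<Rightarrow> complex vec" where
  "ket3 i j k \<equiv> ket [2, 2, 2] [i, j, k]"

text \<open>\<open>regroup es q M\<close> rewrites \<open>M\<close> after a reordering of its tensor factors. The list \<open>es\<close> holds
  the dimensions in the new order, and the \<open>s\<close>-th factor in the old order is put at
  position \<open>q ! s\<close> of the new order.\<close>

definition regroup :: "nat list \<Rightarrow> nat list \<Rightarrow> 'a mat \<Rightarrow> 'a mat" where
  "regroup es q M =
     (let old = (\<lambda>r. index_of (map (nth es) q) (map (nth (digits_of es r)) q))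
      in mat (prod_list es) (prod_list es) (\<lambda>(r, c). M $$ (old r, old c)))"

text \<open>Copies of an operator on \<open>\<complex>\<^sup>a \<otimes> \<complex>\<^sup>b\<close>, viewed as a bipartite operator
  on \<open>(\<complex>\<^sup>a)\<^bsup>\<otimes>n\<^esup> \<otimes> (\<complex>\<^sup>b)\<^bsup>\<otimes>n\<^esup>\<close>.\<close>

fun copies :: "nat \<Rightarrow> nat \<Rightarrow> complex mat \<Rightarrow> nat \<Rightarrow> complex mat" where
  "copies a b \<rho> 0 = 1\<^sub>m 1"
| "copies a b \<rho> (Suc n) = regroup [a, a ^ n, b, b ^ n] [0, 2, 1, 3] (\<rho> \<otimes>\<^sub>m copies a b \<rho> n)"


section \<open>LOCC and distillable entanglement\<close>

text \<open>\<open>locc a b a' b' \<Lambda>\<close>: the map \<open>\<Lambda>\<close> from operators on \<open>\<complex>\<^sup>a \<otimes> \<complex>\<^sup>b\<close> to operators on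
  \<open>\<complex>\<^bsup>a'\<^esup> \<otimes> \<complex>\<^bsup>b'\<^esup>\<close> is implemented by a finite-round LOCC protocol. In each round one party performs
  a local measurement with Kraus operators \<open>K i\<close> (possibly changing the local dimension, which
  covers adding or discarding ancillas) and announces the outcome \<open>i\<close>, on which the rest of the
  protocol may depend. Outcomes that are not used are summed over, so coarse-grained
  instruments are covered as well.\<close>

inductive locc :: "nat \<Rightarrow> nat \<Rightarrow> nat \<Rightarrow> nat \<Rightarrow> (complex mat \<Rightarrow> complex mat) \<Rightarrow> bool" where
  locc_id: "locc a b a b (\<lambda>X. X)"
| locc_left:
  "\<lbrakk>\<And>i. i < n \<Longrightarrow> K i \<in> carrier_mat (e i) a;
    mat_setsum a a (\<lambda>i. mat_adjoint (K i) * K i) {..<n :: nat} = 1\<^sub>m a;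
    \<And>i. i < n \<Longrightarrow> locc (e i) b a' b' (\<Lambda> i)\<rbrakk>
   \<Longrightarrow> locc a b a' b' (\<lambda>X. mat_setsum (a' * b') (a' * b')
         (\<lambda>i. \<Lambda> i ((K i \<otimes>\<^sub>m 1\<^sub>m b) * X * mat_adjoint (K i \<otimes>\<^sub>m 1\<^sub>m b))) {..<n})"
| locc_right:
  "\<lbrakk>\<And>i. i < n \<Longrightarrow> K i \<in> carrier_mat (e i) b;
    mat_setsum b b (\<lambda>i. mat_adjoint (K i) * K i) {..<n :: nat} = 1\<^sub>m b;
    \<And>i. i < n \<Longrightarrow> locc a (e i) a' b' (\<Lambda> i)\<rbrakk>
   \<Longrightarrow> locc a b a' b' (\<lambda>X. mat_setsum (a' * b') (a' * b')
         (\<lambda>i. \<Lambda> i ((1\<^sub>m a \<otimes>\<^sub>m K i) * X * mat_adjoint (1\<^sub>m a \<otimes>\<^sub>m K i))) {..<n})"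

definition bell_state :: "complex mat" where
  "bell_state = (let \<phi> = complex_of_real (1 / sqrt 2) \<cdot>\<^sub>v (ket [2, 2] [0, 0] + ket [2, 2] [1, 1])
                 in outer \<phi> \<phi>)"

text \<open>The target \<open>copies 2 2 bell_state m\<close> is pure, so its fidelity with a state \<open>\<sigma>\<close> is the trace of
  the product; error tending to \<open>0\<close> means fidelity tending to \<open>1\<close>.\<close>

definition achievable_rate :: "nat \<Rightarrow> nat \<Rightarrow> complex mat \<Rightarrow> real \<Rightarrow> bool" where
  "achievable_rate a b \<rho> R \<longleftrightarrow>
     (\<exists>(m :: nat \<Rightarrow> nat) \<Lambda>.
        (\<forall>n. locc (a ^ n) (b ^ n) (2 ^ m n) (2 ^ m n) (\<Lambda> n)) \<and>
        (\<lambda>n. real (m n) / real n) \<longlonglongrightarrow> R \<and>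
        (\<lambda>n. mat_trace (copies 2 2 bell_state (m n) * \<Lambda> n (copies a b \<rho> n))) \<longlonglongrightarrow> 1)"

definition distillable_entanglement :: "nat \<Rightarrow> nat \<Rightarrow> complex mat \<Rightarrow> ereal" where
  "distillable_entanglement a b \<rho> = (SUP R\<in>{R. achievable_rate a b \<rho> R}. ereal R)"


section \<open>Secret-sharing states\<close>

definition even_triples :: "(nat \<times> nat \<times> nat) set" where
  "even_triples = {(i, j, k). i < 2 \<and> j < 2 \<and> k < 2 \<and> even (i + j + k)}"

text \<open>\<open>dA\<close>, \<open>dB\<close>, \<open>dC\<close> are the dimensions of \<open>A'\<close>, \<open>B'\<close>, \<open>C'\<close>; the tensor factors are in the
  order \<open>A, B, C, A', B', C'\<close>.\<close>

definition secret_sharing_state :: "nat \<Rightarrow> nat \<Rightarrow> nat \<Rightarrow> complex mat \<Rightarrow> bool" where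
  "secret_sharing_state dA dB dC \<rho> \<longleftrightarrow>
     density_operator (8 * (dA * dB * dC)) \<rho> \<and>
     (\<exists>\<sigma> U. density_operator (dA * dB * dC) \<sigma> \<and>
       (\<forall>(i, j, k)\<in>even_triples. unitary_operator (dA * dB * dC) (U i j k)) \<and>
       \<rho> = (1 / 4) \<cdot>\<^sub>m mat_setsum (8 * (dA * dB * dC)) (8 * (dA * dB * dC))
         (\<lambda>((i, j, k), (i', j', k')).
            outer (ket3 i j k) (ket3 i' j' k')
              \<otimes>\<^sub>m (U i j k * \<sigma> * mat_adjoint (U i' j' k')))
         (even_triples \<times> even_triples))"

text \<open>The split \<open>AA'\<close>-\<open>BB'CC'\<close>: reordering \<open>A, B, C, A', B', C'\<close> as \<open>A, A', B, B', C, C'\<close>.\<close>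

definition split_state :: "nat \<Rightarrow> nat \<Rightarrow> nat \<Rightarrow> complex mat \<Rightarrow> complex mat" where
  "split_state dA dB dC \<rho> = regroup [2, dA, 2, dB, 2, dC] [0, 2, 4, 1, 3, 5] \<rho>"

definition split_distillable_entanglement :: "nat \<Rightarrow> nat \<Rightarrow> nat \<Rightarrow> complex mat \<Rightarrow> ereal" where
  "split_distillable_entanglement dA dB dC \<rho> =
     distillable_entanglement (2 * dA) (2 * dB * (2 * dC)) (split_state dA dB dC \<rho>)"


section \<open>The family of states\<close>

definition psi :: "nat \<Rightarrow> complex vec" where
  "psi l = (1 / 2) \<cdot>\<^sub>v
     (if l = 0 then ket3 0 0 0 + ket3 0 1 1 + ket3 1 0 1 + ket3 1 1 0
      else if l = 1 then ket3 0 0 0 + ket3 0 1 1 - ket3 1 0 1 - ket3 1 1 0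
      else if l = 2 then ket3 0 0 0 - ket3 0 1 1 + ket3 1 0 1 - ket3 1 1 0
      else ket3 0 0 0 - ket3 0 1 1 - ket3 1 0 1 + ket3 1 1 0)"

definition flip_op :: "nat \<Rightarrow> complex mat" where
  "flip_op d = mat_setsum (d * d) (d * d)
     (\<lambda>(i, j). outer (ket [d, d] [i, j]) (ket [d, d] [j, i])) ({..<d} \<times> {..<d})"

definition rho_s :: "nat \<Rightarrow> complex mat" where
  "rho_s d = (1 / ((of_nat d)\<^sup>2 + of_nat d)) \<cdot>\<^sub>m (1\<^sub>m (d * d) + flip_op d)"

definition rho_a :: "nat \<Rightarrow> complex mat" where
  "rho_a d = (1 / ((of_nat d)\<^sup>2 - of_nat d)) \<cdot>\<^sub>m (1\<^sub>m (d * d) - flip_op d)"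

definition rho :: "real \<Rightarrow> real \<Rightarrow> nat \<Rightarrow> complex mat" where
  "rho a1 a2 d =
     (let P = (\<lambda>l. outer (psi l) (psi l)); Q = (\<lambda>x. outer (ket [2] [x]) (ket [2] [x])) in
        complex_of_real a1 \<cdot>\<^sub>m (P 0 \<otimes>\<^sub>m rho_s d \<otimes>\<^sub>m Q 0)
      + complex_of_real a1 \<cdot>\<^sub>m (P 1 \<otimes>\<^sub>m rho_a d \<otimes>\<^sub>m Q 0)
      + complex_of_real a2 \<cdot>\<^sub>m (P 2 \<otimes>\<^sub>m rho_a d \<otimes>\<^sub>m Q 1)
      + complex_of_real a2 \<cdot>\<^sub>m (P 3 \<otimes>\<^sub>m rho_s d \<otimes>\<^sub>m Q 1))"

end

theory Submission
  imports Defs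
begin

text \<open>The distillable entanglement is bounded by the logarithm of the trace norm of the partial
  transpose. A signed decomposition of the partial transpose into rank-one operators is carried along
  by LOCC operations without changing its total weight, it is multiplicative under tensor products,
  and it has weight at least \<open>2\<^sup>m f\<close> on a state whose fidelity with \<open>m\<close> Bell pairs is \<open>f\<close>.
  For \<open>\<rho>\<^sub>d\<close> the blocks that are diagonal in the key \<open>A\<close> contain \<open>\<rho>\<^sub>s + \<rho>\<^sub>a\<close> and
  contribute \<open>1 + O(1 / d\<^sup>2)\<close>, whereas the off-diagonal blocks contain \<open>\<rho>\<^sub>s - \<rho>\<^sub>a\<close>, which is
  close to a multiple of the flip; the partial transpose of the flip has rank one, so these blocks
  contribute only \<open>O(1 / d)\<close>. The secret-sharing form uses \<open>U\<^bsub>ijk\<^esub> = \<F>\<^sup>i \<otimes> Z\<^sup>k\<close>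
  with the Pauli matrix \<open>Z\<close> on \<open>C'\<close>.\<close>

section \<open>Matrices of bipartite operators\<close>

text \<open>Only upper bounds on the trace norm are ever used, so a decomposition together with its
  weight can stand in for the norm: no spectral decomposition, duality or optimality enters. LOCC
  keeps the weight because a local Kraus operator acts on each vector of the decomposition, by K for
  the first party and by the entrywise conjugate of K for the second, and completeness preserves the
  total squared norm. In this weight the identity on A'B' costs d^2 but the flip only d. In terms of
  identity and flip, \<open>rho_s + rho_a\<close> has coefficients of order d^-2 and d^-3, and
  \<open>rho_s - rho_a\<close> has the same two coefficients exchanged; the exchange is what makes
  the blocks off the diagonal cheap. Those blocks have the shape |u><v| + |v><u| on the key and are
  polarised as |u+v><u+v| - |u><u| - |v><v|, which does not change the order in d. The resulting
  constant is (d^2 + 4d + 1) / (d^2 - 1). Convergence to 0 also needs a lower bound, since the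
  supremum of an empty set of rates would be minus infinity; throwing both systems away achieves
  rate 0.\<close>

lemma mat_adjoint_carrier: "A \<in> carrier_mat m n \<Longrightarrow> mat_adjoint A \<in> carrier_mat n m"
  by (auto simp: mat_adjoint_def mat_of_rows_def)

lemma mat_adjoint_dims [simp]:
  "dim_row (mat_adjoint A) = dim_col A" "dim_col (mat_adjoint A) = dim_row A"
  by (auto simp: mat_adjoint_def mat_of_rows_def)

lemma mat_adjoint_index [simp]:
  fixes A :: "complex mat"
  assumes "i < dim_col A" "j < dim_row A"
  shows "mat_adjoint A $$ (i, j) = cnj (A $$ (j, i))"
  using assms by (simp add: mat_adjoint_def mat_of_rows_index)

lemma mat_setsum_index [simp]:
  "i < r \<Longrightarrow> j < c \<Longrightarrow> mat_setsum r c f S $$ (i, j) = (\<Sum>k\<in>S. f k $$ (i, j))"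
  by (simp add: mat_setsum_def)

lemma mat_setsum_dims [simp]:
  "dim_row (mat_setsum r c f S) = r" "dim_col (mat_setsum r c f S) = c"
  by (simp_all add: mat_setsum_def)

lemma mat_setsum_carrier [simp]: "mat_setsum r c f S \<in> carrier_mat r c"
  by (simp add: mat_setsum_def)

lemma kron_dims [simp]:
  "dim_row (M \<otimes>\<^sub>m N) = dim_row M * dim_row N" "dim_col (M \<otimes>\<^sub>m N) = dim_col M * dim_col N"
  by (simp_all add: kron_def)

lemma kron_index:
  "r < dim_row M * dim_row N \<Longrightarrow> c < dim_col M * dim_col N \<Longrightarrow>
   (M \<otimes>\<^sub>m N) $$ (r, c) = M $$ (r div dim_row N, c div dim_col N) * N $$ (r mod dim_row N, c mod dim_col N)"
  by (simp add: kron_def)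

lemma pair_index_less:
  fixes i k a b :: nat
  assumes "i < a" "k < b"
  shows "i * b + k < a * b"
proof -
  have "i * b + k < (i + 1) * b" using assms by simp
  also have "\<dots> \<le> a * b" using assms by (intro mult_right_mono) auto
  finally show ?thesis .
qed

lemma pair_div_mod:
  fixes i k b :: nat
  assumes "k < b"
  shows "(i * b + k) div b = i" "(i * b + k) mod b = k"
  using assms by auto

lemma div_mod_less:
  fixes r a b :: nat
  assumes "r < a * b"
  shows "r div b < a" "r mod b < b"
  using assms by (auto simp: less_mult_imp_div_less intro!: mod_less_divisor gr0I)

lemma sum_pair_index:
  fixes f :: "nat \<Rightarrow> 'a::comm_monoid_add"
  shows "(\<Sum>r<a * b. f r) = (\<Sum>i<a. \<Sum>k<b. f (i * b + k))"
proof -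
  have "(\<Sum>r<a * b. f r) = (\<Sum>m<a. sum f {m * b..<m * b + b})"
    by (simp add: sum.nat_group)
  also have "\<dots> = (\<Sum>i<a. \<Sum>k<b. f (i * b + k))"
  proof (rule sum.cong[OF refl])
    fix i
    show "sum f {i * b..<i * b + b} = (\<Sum>k<b. f (i * b + k))"
      using sum.shift_bounds_nat_ivl[of f 0 "i * b" b] by (simp add: lessThan_atLeast0 add.commute)
  qed
  finally show ?thesis .
qed

text \<open>Rows carry the digits \<open>i\<close>, \<open>k\<close> and columns the digits
  \<open>j\<close>, \<open>l\<close> of the first and second party. With the four digits kept apart,
  partial transposition is just the exchange of \<open>k\<close> and \<open>l\<close>.\<close>

definition bip :: "nat \<Rightarrow> nat \<Rightarrow> (nat \<Rightarrow> nat \<Rightarrow> nat \<Rightarrow> nat \<Rightarrow> 'a) \<Rightarrow> 'a mat" where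
  "bip a b f = mat (a * b) (a * b) (\<lambda>(r, c). f (r div b) (r mod b) (c div b) (c mod b))"

definition entries :: "nat \<Rightarrow> 'a mat \<Rightarrow> nat \<Rightarrow> nat \<Rightarrow> nat \<Rightarrow> nat \<Rightarrow> 'a" where
  "entries b M i k j l = M $$ (i * b + k, j * b + l)"

lemma bip_carrier [simp]: "bip a b f \<in> carrier_mat (a * b) (a * b)"
  by (simp add: bip_def)

lemma bip_dims [simp]: "dim_row (bip a b f) = a * b" "dim_col (bip a b f) = a * b"
  by (simp_all add: bip_def)

lemma bip_index:
  "r < a * b \<Longrightarrow> c < a * b \<Longrightarrow> bip a b f $$ (r, c) = f (r div b) (r mod b) (c div b) (c mod b)"
  by (simp add: bip_def)

lemma bip_pair_index [simp]:
  "i < a \<Longrightarrow> k < b \<Longrightarrow> j < a \<Longrightarrow> l < b \<Longrightarrow> bip a b f $$ (i * b + k, j * b + l) = f i k j l"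
  by (simp add: bip_def pair_index_less pair_div_mod)

lemma bip_cong:
  "(\<And>i k j l. i < a \<Longrightarrow> k < b \<Longrightarrow> j < a \<Longrightarrow> l < b \<Longrightarrow> f i k j l = g i k j l) \<Longrightarrow> bip a b f = bip a b g"
  by (intro eq_matI) (auto simp: bip_index div_mod_less)

lemma bip_entries: "M \<in> carrier_mat (a * b) (a * b) \<Longrightarrow> bip a b (entries b M) = M"
  by (intro eq_matI) (auto simp: bip_index entries_def)

lemma eq_bipI:
  assumes "M \<in> carrier_mat (a * b) (a * b)"
    and "\<And>i k j l. i < a \<Longrightarrow> k < b \<Longrightarrow> j < a \<Longrightarrow> l < b \<Longrightarrow> M $$ (i * b + k, j * b + l) = f i k j l"
  shows "M = bip a b f"
proof -
  have "M = bip a b (entries b M)" using assms(1) by (simp add: bip_entries)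
  also have "\<dots> = bip a b f" by (rule bip_cong) (simp add: entries_def assms(2))
  finally show ?thesis .
qed

lemma conj_index:
  fixes A X :: "complex mat"
  assumes A: "A \<in> carrier_mat m n" and X: "X \<in> carrier_mat n n" and r: "r < m" and c: "c < m"
  shows "(A * X * mat_adjoint A) $$ (r, c) = (\<Sum>t<n. \<Sum>s<n. A $$ (r, t) * X $$ (t, s) * cnj (A $$ (c, s)))"
proof -
  have "(A * X * mat_adjoint A) $$ (r, c) = (\<Sum>s<n. (\<Sum>t<n. A $$ (r, t) * X $$ (t, s)) * cnj (A $$ (c, s)))"
    using assms by (auto simp: scalar_prod_def lessThan_atLeast0 intro!: sum.cong)
  also have "\<dots> = (\<Sum>t<n. \<Sum>s<n. A $$ (r, t) * X $$ (t, s) * cnj (A $$ (c, s)))"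
    unfolding sum_distrib_right by (rule sum.swap)
  finally show ?thesis .
qed

text \<open>The Kronecker delta of the identity factor removes two of the four sums, so the digits
  of the second party are mere parameters of the result.\<close>

lemma conj_left:
  fixes f :: "nat \<Rightarrow> nat \<Rightarrow> nat \<Rightarrow> nat \<Rightarrow> complex"
  assumes K: "K \<in> carrier_mat e a"
  shows "(K \<otimes>\<^sub>m 1\<^sub>m b) * bip a b f * mat_adjoint (K \<otimes>\<^sub>m 1\<^sub>m b)
    = bip e b (\<lambda>i k j l. \<Sum>i'<a. \<Sum>j'<a. K $$ (i, i') * f i' k j' l * cnj (K $$ (j, j')))"
proof (rule eq_bipI)
  have KK: "K \<otimes>\<^sub>m 1\<^sub>m b \<in> carrier_mat (e * b) (a * b)" using K by auto
  show "(K \<otimes>\<^sub>m 1\<^sub>m b) * bip a b f * mat_adjoint (K \<otimes>\<^sub>m 1\<^sub>m b) \<in> carrier_mat (e * b) (e * b)"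
    using KK by (intro carrier_matI) auto
  fix i k j l assume b: "i < e" "k < b" "j < e" "l < b"
  have ent: "(K \<otimes>\<^sub>m 1\<^sub>m b) $$ (i * b + k, i' * b + k') = (if k = k' then K $$ (i, i') else 0)"
    if "i < e" "k < b" "i' < a" "k' < b" for i k i' k'
    using that K by (simp add: kron_index pair_index_less pair_div_mod)
  have "((K \<otimes>\<^sub>m 1\<^sub>m b) * bip a b f * mat_adjoint (K \<otimes>\<^sub>m 1\<^sub>m b)) $$ (i * b + k, j * b + l)
    = (\<Sum>i'<a. \<Sum>k'<b. \<Sum>j'<a. \<Sum>l'<b. (K \<otimes>\<^sub>m 1\<^sub>m b) $$ (i * b + k, i' * b + k') * f i' k' j' l' *
         cnj ((K \<otimes>\<^sub>m 1\<^sub>m b) $$ (j * b + l, j' * b + l')))"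
    using b by (simp add: conj_index[OF KK bip_carrier] pair_index_less sum_pair_index)
  also have "\<dots> = (\<Sum>i'<a. \<Sum>k'<b. \<Sum>j'<a. \<Sum>l'<b. 
       if l = l' then if k = k' then K $$ (i, i') * f i' k' j' l' * cnj (K $$ (j, j')) else 0 else 0)"
    using b by (intro sum.cong refl) (simp add: ent)
  also have "\<dots> = (\<Sum>i'<a. \<Sum>k'<b. if k = k' then \<Sum>j'<a. K $$ (i, i') * f i' k' j' l * cnj (K $$ (j, j')) else 0)"
    using b by (intro sum.cong refl) (simp)
  also have "\<dots> = (\<Sum>i'<a. \<Sum>j'<a. K $$ (i, i') * f i' k j' l * cnj (K $$ (j, j')))"
    using b by simp
  finally show "((K \<otimes>\<^sub>m 1\<^sub>m b) * bip a b f * mat_adjoint (K \<otimes>\<^sub>m 1\<^sub>m b)) $$ (i * b + k, j * b + l)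
    = (\<Sum>i'<a. \<Sum>j'<a. K $$ (i, i') * f i' k j' l * cnj (K $$ (j, j')))" .
qed

lemma conj_right:
  fixes f :: "nat \<Rightarrow> nat \<Rightarrow> nat \<Rightarrow> nat \<Rightarrow> complex"
  assumes K: "K \<in> carrier_mat e b"
  shows "(1\<^sub>m a \<otimes>\<^sub>m K) * bip a b f * mat_adjoint (1\<^sub>m a \<otimes>\<^sub>m K)
    = bip a e (\<lambda>i k j l. \<Sum>k'<b. \<Sum>l'<b. K $$ (k, k') * f i k' j l' * cnj (K $$ (l, l')))"
proof (rule eq_bipI)
  have KK: "1\<^sub>m a \<otimes>\<^sub>m K \<in> carrier_mat (a * e) (a * b)" using K by auto
  show "(1\<^sub>m a \<otimes>\<^sub>m K) * bip a b f * mat_adjoint (1\<^sub>m a \<otimes>\<^sub>m K) \<in> carrier_mat (a * e) (a * e)"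
    using KK by (intro carrier_matI) auto
  fix i k j l assume b: "i < a" "k < e" "j < a" "l < e"
  have ent: "(1\<^sub>m a \<otimes>\<^sub>m K) $$ (i * e + k, i' * b + k') = (if i = i' then K $$ (k, k') else 0)"
    if "i < a" "k < e" "i' < a" "k' < b" for i k i' k'
    using that K by (simp add: kron_index pair_index_less pair_div_mod)
  have "((1\<^sub>m a \<otimes>\<^sub>m K) * bip a b f * mat_adjoint (1\<^sub>m a \<otimes>\<^sub>m K)) $$ (i * e + k, j * e + l)
    = (\<Sum>i'<a. \<Sum>k'<b. \<Sum>j'<a. \<Sum>l'<b. (1\<^sub>m a \<otimes>\<^sub>m K) $$ (i * e + k, i' * b + k') * f i' k' j' l' *
         cnj ((1\<^sub>m a \<otimes>\<^sub>m K) $$ (j * e + l, j' * b + l')))"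
    using b by (simp add: conj_index[OF KK bip_carrier] pair_index_less sum_pair_index)
  also have "\<dots> = (\<Sum>i'<a. \<Sum>k'<b. \<Sum>j'<a. if j = j' then \<Sum>l'<b. 
       if i = i' then K $$ (k, k') * f i' k' j' l' * cnj (K $$ (l, l')) else 0 else 0)"
    using b by (intro sum.cong refl) (simp add: ent)
  also have "\<dots> = (\<Sum>i'<a. if i = i' then \<Sum>k'<b. \<Sum>l'<b. K $$ (k, k') * f i' k' j l' * cnj (K $$ (l, l')) else 0)"
    using b by (intro sum.cong refl) (simp)
  also have "\<dots> = (\<Sum>k'<b. \<Sum>l'<b. K $$ (k, k') * f i k' j l' * cnj (K $$ (l, l')))"
    using b by simp
  finally show "((1\<^sub>m a \<otimes>\<^sub>m K) * bip a b f * mat_adjoint (1\<^sub>m a \<otimes>\<^sub>m K)) $$ (i * e + k, j * e + l)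
    = (\<Sum>k'<b. \<Sum>l'<b. K $$ (k, k') * f i k' j l' * cnj (K $$ (l, l')))" .
qed

section \<open>Tensor products regrouped by party\<close>

definition tens :: "nat \<Rightarrow> nat \<Rightarrow> (nat \<Rightarrow> nat \<Rightarrow> nat \<Rightarrow> nat \<Rightarrow> complex) \<Rightarrow>
    (nat \<Rightarrow> nat \<Rightarrow> nat \<Rightarrow> nat \<Rightarrow> complex) \<Rightarrow> nat \<Rightarrow> nat \<Rightarrow> nat \<Rightarrow> nat \<Rightarrow> complex" where
  "tens a b f g i k j l = f (i div a) (k div b) (j div a) (l div b) * g (i mod a) (k mod b) (j mod a) (l mod b)"

lemma regroup_copies_old:
  assumes "i < a" "i' < a'" "k < b" "k' < b'"
  shows "index_of (map (nth [a, a', b, b']) [0, 2, 1, 3])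
      (map (nth (digits_of [a, a', b, b'] ((i * a' + i') * (b * b') + (k * b' + k')))) [0, 2, 1, 3])
    = (i * b + k) * (a' * b') + (i' * b' + k')"
proof -
  have l1: "k * b' + k' < b * b'" using assms by (simp add: pair_index_less)
  have l2: "i' * (b * b') + (k * b' + k') < a' * (b * b')" using assms l1 by (intro pair_index_less) auto
  \<comment> \<open>With nested place values each \<open>div\<close> and \<open>mod\<close> strips
    exactly the leading digit, which is how \<open>digits_of\<close> evaluates.\<close>
  have e: "(i * a' + i') * (b * b') + (k * b' + k') = i * (a' * (b * b')) + (i' * (b * b') + (k * b' + k'))"
    by (simp add: algebra_simps)
  show ?thesis unfolding e using assms l1 l2
    by (simp add: pair_div_mod numeral_2_eq_2 numeral_3_eq_3) (simp add: algebra_simps)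
qed

lemma regroup_kron_bip:
  "regroup [a, a', b, b'] [0, 2, 1, 3] (bip a b f \<otimes>\<^sub>m bip a' b' g) = bip (a * a') (b * b') (tens a' b' f g)"
proof (rule eq_bipI)
  show "regroup [a, a', b, b'] [0, 2, 1, 3] (bip a b f \<otimes>\<^sub>m bip a' b' g)
     \<in> carrier_mat (a * a' * (b * b')) (a * a' * (b * b'))"
    by (simp add: regroup_def Let_def mult.assoc)
next
  fix i k j l assume b: "i < a * a'" "k < b * b'" "j < a * a'" "l < b * b'"
  define i1 i2 j1 j2 k1 k2 l1 l2 where defs: "i1 = i div a'" "i2 = i mod a'" "j1 = j div a'" "j2 = j mod a'"
     "k1 = k div b'" "k2 = k mod b'" "l1 = l div b'" "l2 = l mod b'"
  have d: "i = i1 * a' + i2" "j = j1 * a' + j2" "k = k1 * b' + k2" "l = l1 * b' + l2"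
    by (simp_all add: defs)
  have r: "i1 < a" "i2 < a'" "j1 < a" "j2 < a'" "k1 < b" "k2 < b'" "l1 < b" "l2 < b'"
    using b by (simp_all add: defs div_mod_less)
  have p: "i * (b * b') + k < prod_list [a, a', b, b']" "j * (b * b') + l < prod_list [a, a', b, b']"
    using pair_index_less[OF b(1,2)] pair_index_less[OF b(3,4)] by (simp_all add: mult.assoc)
  have q: "(i1 * b + k1) * (a' * b') + (i2 * b' + k2) < a * b * (a' * b')"
          "(j1 * b + l1) * (a' * b') + (j2 * b' + l2) < a * b * (a' * b')"
    using r by (intro pair_index_less; simp)+
  have s: "i2 * b' + k2 < a' * b'" "j2 * b' + l2 < a' * b'" using r by (intro pair_index_less; simp)+
  have "regroup [a, a', b, b'] [0, 2, 1, 3] (bip a b f \<otimes>\<^sub>m bip a' b' g) $$ (i * (b * b') + k, j * (b * b') + l)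
    = (bip a b f \<otimes>\<^sub>m bip a' b' g) $$ ((i1 * b + k1) * (a' * b') + (i2 * b' + k2), (j1 * b + l1) * (a' * b') + (j2 * b' + l2))"
    using p regroup_copies_old[OF r(1,2,5,6)] regroup_copies_old[OF r(3,4,7,8)]
    unfolding regroup_def Let_def d by (simp only: index_mat split)
  also have "\<dots> = f i1 k1 j1 l1 * g i2 k2 j2 l2"
    using q r s by (simp add: kron_index pair_div_mod)
  finally show "regroup [a, a', b, b'] [0, 2, 1, 3] (bip a b f \<otimes>\<^sub>m bip a' b' g) $$ (i * (b * b') + k, j * (b * b') + l)
    = tens a' b' f g i k j l"
    by (simp add: tens_def defs)
qed

section \<open>Decompositions of the partial transpose\<close>

definition sqn :: "nat \<Rightarrow> nat \<Rightarrow> (nat \<Rightarrow> nat \<Rightarrow> complex) \<Rightarrow> real" where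
  "sqn a b W = (\<Sum>i<a. \<Sum>k<b. (cmod (W i k))\<^sup>2)"

text \<open>The indices \<open>k\<close> and \<open>l\<close> are exchanged: this is the partial transpose (on the second party) of
  the rank-one operator of the vector with coefficients \<open>W\<close>.\<close>

definition ptsq :: "nat \<Rightarrow> nat \<Rightarrow> (nat \<Rightarrow> nat \<Rightarrow> complex) \<Rightarrow> complex mat" where
  "ptsq a b W = bip a b (\<lambda>i k j l. W i l * cnj (W j k))"

text \<open>\<open>ptd a b c M\<close>: the partial transpose of \<open>M\<close> is a real combination of rank-one operators of
  total weight \<open>c\<close>. Hence its trace norm is at most \<open>c\<close>.\<close>

inductive ptd :: "nat \<Rightarrow> nat \<Rightarrow> real \<Rightarrow> complex mat \<Rightarrow> bool" for a b where
  ptd_zero: "ptd a b 0 (0\<^sub>m (a * b) (a * b))"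
| ptd_base: "ptd a b (\<bar>s\<bar> * sqn a b W) (complex_of_real s \<cdot>\<^sub>m ptsq a b W)"
| ptd_add: "ptd a b c M \<Longrightarrow> ptd a b c' M' \<Longrightarrow> ptd a b (c + c') (M + M')"

lemma ptsq_carrier [simp]: "ptsq a b W \<in> carrier_mat (a * b) (a * b)"
  by (simp add: ptsq_def)

lemma ptd_carrier: "ptd a b c M \<Longrightarrow> M \<in> carrier_mat (a * b) (a * b)"
  by (induction rule: ptd.induct) auto

lemma ptd_setsum:
  assumes "finite S" "\<And>n. n \<in> S \<Longrightarrow> ptd a b (c n) (f n)"
  shows "ptd a b (\<Sum>n\<in>S. c n) (mat_setsum (a * b) (a * b) f S)"
  using assms
proof (induction S rule: finite_induct)
  case empty
  have "mat_setsum (a * b) (a * b) f {} = 0\<^sub>m (a * b) (a * b)" by (intro eq_matI) auto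
  then show ?case by (simp add: ptd_zero)
next
  case (insert x S)
  then have "f x \<in> carrier_mat (a * b) (a * b)" by (auto intro: ptd_carrier)
  then have "mat_setsum (a * b) (a * b) f (insert x S) = f x + mat_setsum (a * b) (a * b) f S"
    using insert by (intro eq_matI) auto
  then show ?case using insert by (auto intro: ptd_add)
qed

lemma smult_bip: "s \<cdot>\<^sub>m bip a b f = bip a b (\<lambda>i k j l. s * f i k j l)"
  by (intro eq_matI) (auto simp: bip_index)

lemma conj_smult:
  fixes A X :: "complex mat"
  assumes "A \<in> carrier_mat m n" "X \<in> carrier_mat n n"
  shows "A * (s \<cdot>\<^sub>m X) * mat_adjoint A = s \<cdot>\<^sub>m (A * X * mat_adjoint A)"
  using mat_adjoint_carrier[OF assms(1)] assms
  by (metis mult_carrier_mat mult_smult_assoc_mat mult_smult_distrib)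

lemma conj_add:
  fixes A X Y :: "complex mat"
  assumes "A \<in> carrier_mat m n" "X \<in> carrier_mat n n" "Y \<in> carrier_mat n n"
  shows "A * (X + Y) * mat_adjoint A = A * X * mat_adjoint A + A * Y * mat_adjoint A"
proof -
  have "A * (X + Y) = A * X + A * Y" using assms by (simp add: mult_add_distrib_mat)
  then show ?thesis using mat_adjoint_carrier[OF assms(1)] assms
    by (simp add: add_mult_distrib_mat[of _ m n _ _ m])
qed

lemma conj_zero:
  fixes A :: "complex mat"
  assumes "A \<in> carrier_mat m n"
  shows "A * 0\<^sub>m n n * mat_adjoint A = 0\<^sub>m m m"
  using mat_adjoint_carrier[OF assms(1)] assms by simp

section \<open>Local Kraus operators acting on a decomposition\<close>

lemma conj_left_ptsq:
  assumes K: "K \<in> carrier_mat e a"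
  shows "(K \<otimes>\<^sub>m 1\<^sub>m b) * ptsq a b W * mat_adjoint (K \<otimes>\<^sub>m 1\<^sub>m b) = ptsq e b (\<lambda>i k. \<Sum>i'<a. K $$ (i, i') * W i' k)"
  unfolding ptsq_def conj_left[OF K]
  by (rule bip_cong) (simp add: sum_product mult_ac)

text \<open>Because \<open>k\<close> and \<open>l\<close> are exchanged in \<open>ptsq\<close>, the
  factor \<open>K\<close> now meets the conjugated amplitude and \<open>cnj K\<close> the plain one.
  The vector is therefore transformed by the entrywise conjugate of \<open>K\<close>.\<close>

lemma conj_right_ptsq:
  assumes K: "K \<in> carrier_mat e b"
  shows "(1\<^sub>m a \<otimes>\<^sub>m K) * ptsq a b W * mat_adjoint (1\<^sub>m a \<otimes>\<^sub>m K) = ptsq a e (\<lambda>i k. \<Sum>k'<b. W i k' * cnj (K $$ (k, k')))"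
  unfolding ptsq_def conj_right[OF K]
proof (rule bip_cong)
  fix i k j l
  have "(\<Sum>k'<b. \<Sum>l'<b. K $$ (k, k') * (W i l' * cnj (W j k')) * cnj (K $$ (l, l')))
    = (\<Sum>l'<b. \<Sum>k'<b. K $$ (k, k') * (W i l' * cnj (W j k')) * cnj (K $$ (l, l')))"
    by (rule sum.swap)
  then show "(\<Sum>k'<b. \<Sum>l'<b. K $$ (k, k') * (W i l' * cnj (W j k')) * cnj (K $$ (l, l')))
     = (\<Sum>k'<b. W i k' * cnj (K $$ (l, k'))) * cnj (\<Sum>k'<b. W j k' * cnj (K $$ (k, k')))"
    by (simp add: sum_product mult_ac)
qed

text \<open>Stacking the Kraus operators on top of each other gives a single matrix; completeness
  says that its columns are orthonormal (\<open>ent\<close>), so it preserves the norm. Outcomes may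
  have different output dimensions \<open>e n\<close>.\<close>

lemma kraus_isometry:
  fixes w :: "nat \<Rightarrow> complex" and N :: nat
  assumes K: "\<And>n. n < N \<Longrightarrow> K n \<in> carrier_mat (e n) a"
    and one: "mat_setsum a a (\<lambda>n. mat_adjoint (K n) * K n) {..<N} = 1\<^sub>m a"
  shows "(\<Sum>n<N. \<Sum>i<e n. (cmod (\<Sum>j<a. K n $$ (i, j) * w j))\<^sup>2) = (\<Sum>j<a. (cmod (w j))\<^sup>2)"
proof -
  have ent: "(\<Sum>n<N. \<Sum>i<e n. K n $$ (i, j) * cnj (K n $$ (i, l))) = (if j = l then 1 else 0)"
    if "j < a" "l < a" for j l
  proof -
    have "(1\<^sub>m a :: complex mat) $$ (l, j) = (\<Sum>n<N. (mat_adjoint (K n) * K n) $$ (l, j))"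
      using that by (subst one[symmetric]) simp
    also have "\<dots> = (\<Sum>n<N. \<Sum>i<e n. K n $$ (i, j) * cnj (K n $$ (i, l)))"
    proof (rule sum.cong[OF refl])
      fix n assume "n \<in> {..<N}"
      then have "K n \<in> carrier_mat (e n) a" using K by simp
      then show "(mat_adjoint (K n) * K n) $$ (l, j) = (\<Sum>i<e n. K n $$ (i, j) * cnj (K n $$ (i, l)))"
        using that by (auto simp: scalar_prod_def lessThan_atLeast0 intro!: sum.cong)
    qed
    finally show ?thesis using that by (cases "j = l") (simp_all add: eq_commute[of "0 :: complex"] eq_commute[of "1 :: complex"])
  qed
  have "complex_of_real (\<Sum>n<N. \<Sum>i<e n. (cmod (\<Sum>j<a. K n $$ (i, j) * w j))\<^sup>2)
    = (\<Sum>n<N. \<Sum>i<e n. \<Sum>j<a. \<Sum>l<a. (K n $$ (i, j) * w j) * cnj (K n $$ (i, l) * w l))"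
    by (simp only: of_real_sum complex_norm_square cnj_sum sum_product)
  also have "\<dots> = (\<Sum>j<a. \<Sum>l<a. \<Sum>n<N. \<Sum>i<e n. (K n $$ (i, j) * w j) * cnj (K n $$ (i, l) * w l))"
  proof -
    have "(\<Sum>n<N. \<Sum>i<e n. \<Sum>j<a. \<Sum>l<a. (K n $$ (i, j) * w j) * cnj (K n $$ (i, l) * w l))
      = (\<Sum>n<N. \<Sum>j<a. \<Sum>i<e n. \<Sum>l<a. (K n $$ (i, j) * w j) * cnj (K n $$ (i, l) * w l))"
      by (intro sum.cong[OF refl] sum.swap)
    also have "\<dots> = (\<Sum>n<N. \<Sum>j<a. \<Sum>l<a. \<Sum>i<e n. (K n $$ (i, j) * w j) * cnj (K n $$ (i, l) * w l))"
      by (intro sum.cong[OF refl] sum.swap)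
    also have "\<dots> = (\<Sum>j<a. \<Sum>n<N. \<Sum>l<a. \<Sum>i<e n. (K n $$ (i, j) * w j) * cnj (K n $$ (i, l) * w l))"
      by (rule sum.swap)
    also have "\<dots> = (\<Sum>j<a. \<Sum>l<a. \<Sum>n<N. \<Sum>i<e n. (K n $$ (i, j) * w j) * cnj (K n $$ (i, l) * w l))"
      by (intro sum.cong[OF refl] sum.swap)
    finally show ?thesis .
  qed
  also have "\<dots> = (\<Sum>j<a. \<Sum>l<a. (w j * cnj (w l)) * (\<Sum>n<N. \<Sum>i<e n. K n $$ (i, j) * cnj (K n $$ (i, l))))"
    by (simp add: sum_distrib_left mult_ac)
  also have "\<dots> = (\<Sum>j<a. \<Sum>l<a. if j = l then w j * cnj (w l) else 0)"
    by (intro sum.cong refl) (simp add: ent)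
  also have "\<dots> = complex_of_real (\<Sum>j<a. (cmod (w j))\<^sup>2)"
    by (simp add: complex_norm_square del: of_real_power)
  finally show ?thesis using of_real_eq_iff by blast
qed

lemma sqn_kraus_left:
  fixes N :: nat
  assumes "\<And>n. n < N \<Longrightarrow> K n \<in> carrier_mat (e n) a"
    and "mat_setsum a a (\<lambda>n. mat_adjoint (K n) * K n) {..<N} = 1\<^sub>m a"
  shows "(\<Sum>n<N. sqn (e n) b (\<lambda>i k. \<Sum>i'<a. K n $$ (i, i') * W i' k)) = sqn a b W"
proof -
  have "(\<Sum>n<N. sqn (e n) b (\<lambda>i k. \<Sum>i'<a. K n $$ (i, i') * W i' k))
    = (\<Sum>n<N. \<Sum>k<b. \<Sum>i<e n. (cmod (\<Sum>i'<a. K n $$ (i, i') * W i' k))\<^sup>2)"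
    unfolding sqn_def by (intro sum.cong[OF refl] sum.swap)
  also have "\<dots> = (\<Sum>k<b. \<Sum>n<N. \<Sum>i<e n. (cmod (\<Sum>i'<a. K n $$ (i, i') * W i' k))\<^sup>2)"
    by (rule sum.swap)
  also have "\<dots> = (\<Sum>k<b. \<Sum>j<a. (cmod (W j k))\<^sup>2)"
    by (intro sum.cong[OF refl] kraus_isometry assms)
  also have "\<dots> = sqn a b W" unfolding sqn_def by (rule sum.swap)
  finally show ?thesis .
qed

lemma sqn_kraus_right:
  fixes N :: nat
  assumes "\<And>n. n < N \<Longrightarrow> K n \<in> carrier_mat (e n) b"
    and "mat_setsum b b (\<lambda>n. mat_adjoint (K n) * K n) {..<N} = 1\<^sub>m b"
  shows "(\<Sum>n<N. sqn a (e n) (\<lambda>i k. \<Sum>k'<b. W i k' * cnj (K n $$ (k, k')))) = sqn a b W"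
proof -
  \<comment> \<open>Conjugating inside the modulus trades the conjugated Kraus operators for the
    original ones acting on \<open>cnj W\<close>, so that completeness applies unchanged.\<close>
  have flip: "cmod (\<Sum>k'<b. W i k' * cnj (K n $$ (k, k'))) = cmod (\<Sum>k'<b. K n $$ (k, k') * cnj (W i k'))"
    for i n k
    by (subst complex_mod_cnj[symmetric]) (simp add: mult.commute)
  have "(\<Sum>n<N. sqn a (e n) (\<lambda>i k. \<Sum>k'<b. W i k' * cnj (K n $$ (k, k'))))
    = (\<Sum>i<a. \<Sum>n<N. \<Sum>k<e n. (cmod (\<Sum>k'<b. K n $$ (k, k') * cnj (W i k')))\<^sup>2)"
    unfolding sqn_def flip by (rule sum.swap)
  also have "\<dots> = (\<Sum>i<a. \<Sum>k<b. (cmod (cnj (W i k)))\<^sup>2)"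
    by (intro sum.cong[OF refl] kraus_isometry assms)
  finally show ?thesis by (simp add: sqn_def)
qed

text \<open>How the weight is shared among the outcomes depends on the decomposition, hence the
  existential \<open>c'\<close>; only the total is determined, and it is exactly
  \<open>c\<close>.\<close>

lemma ptd_kraus_left:
  fixes N :: nat
  assumes "ptd a b c M"
    and K: "\<And>n. n < N \<Longrightarrow> K n \<in> carrier_mat (e n) a"
    and one: "mat_setsum a a (\<lambda>n. mat_adjoint (K n) * K n) {..<N} = 1\<^sub>m a"
  shows "\<exists>c'. (\<forall>n<N. ptd (e n) b (c' n) ((K n \<otimes>\<^sub>m 1\<^sub>m b) * M * mat_adjoint (K n \<otimes>\<^sub>m 1\<^sub>m b))) \<and> (\<Sum>n<N. c' n) = c"
  using assms(1)
proof (induction rule: ptd.induct)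
  case ptd_zero
  have "\<forall>n<N. ptd (e n) b 0 ((K n \<otimes>\<^sub>m 1\<^sub>m b) * 0\<^sub>m (a * b) (a * b) * mat_adjoint (K n \<otimes>\<^sub>m 1\<^sub>m b))"
  proof (intro allI impI)
    fix n assume "n < N"
    then have "K n \<otimes>\<^sub>m 1\<^sub>m b \<in> carrier_mat (e n * b) (a * b)" using K[of n] by auto
    from conj_zero[OF this] show "ptd (e n) b 0 ((K n \<otimes>\<^sub>m 1\<^sub>m b) * 0\<^sub>m (a * b) (a * b) * mat_adjoint (K n \<otimes>\<^sub>m 1\<^sub>m b))"
      by (simp add: ptd.ptd_zero)
  qed
  then show ?case by (intro exI[of _ "\<lambda>_. 0"]) simp
next
  case (ptd_base s W)
  let ?W = "\<lambda>n i k. \<Sum>i'<a. K n $$ (i, i') * W i' k"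
  have "\<forall>n<N. ptd (e n) b (\<bar>s\<bar> * sqn (e n) b (?W n))
     ((K n \<otimes>\<^sub>m 1\<^sub>m b) * (complex_of_real s \<cdot>\<^sub>m ptsq a b W) * mat_adjoint (K n \<otimes>\<^sub>m 1\<^sub>m b))"
  proof (intro allI impI)
    fix n assume "n < N"
    then have "K n \<in> carrier_mat (e n) a" "K n \<otimes>\<^sub>m 1\<^sub>m b \<in> carrier_mat (e n * b) (a * b)" using K[of n] by auto
    then show "ptd (e n) b (\<bar>s\<bar> * sqn (e n) b (?W n))
     ((K n \<otimes>\<^sub>m 1\<^sub>m b) * (complex_of_real s \<cdot>\<^sub>m ptsq a b W) * mat_adjoint (K n \<otimes>\<^sub>m 1\<^sub>m b))"
      by (simp add: conj_smult[of _ _ "a * b"] conj_left_ptsq ptd.ptd_base)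
  qed
  moreover have "(\<Sum>n<N. \<bar>s\<bar> * sqn (e n) b (?W n)) = \<bar>s\<bar> * sqn a b W"
    by (simp add: sum_distrib_left[symmetric] sqn_kraus_left[OF K one])
  ultimately show ?case by (intro exI[of _ "\<lambda>n. \<bar>s\<bar> * sqn (e n) b (?W n)"] conjI)
next
  case (ptd_add c M c' M')
  then obtain x y where
    x: "\<forall>n<N. ptd (e n) b (x n) ((K n \<otimes>\<^sub>m 1\<^sub>m b) * M * mat_adjoint (K n \<otimes>\<^sub>m 1\<^sub>m b))" "(\<Sum>n<N. x n) = c" and
    y: "\<forall>n<N. ptd (e n) b (y n) ((K n \<otimes>\<^sub>m 1\<^sub>m b) * M' * mat_adjoint (K n \<otimes>\<^sub>m 1\<^sub>m b))" "(\<Sum>n<N. y n) = c'"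
    by blast
  have "\<forall>n<N. ptd (e n) b (x n + y n) ((K n \<otimes>\<^sub>m 1\<^sub>m b) * (M + M') * mat_adjoint (K n \<otimes>\<^sub>m 1\<^sub>m b))"
  proof (intro allI impI)
    fix n assume n: "n < N"
    then have "K n \<otimes>\<^sub>m 1\<^sub>m b \<in> carrier_mat (e n * b) (a * b)" using K[of n] by auto
    from conj_add[OF this ptd_carrier[OF ptd_add.hyps(1)] ptd_carrier[OF ptd_add.hyps(2)]]
    show "ptd (e n) b (x n + y n) ((K n \<otimes>\<^sub>m 1\<^sub>m b) * (M + M') * mat_adjoint (K n \<otimes>\<^sub>m 1\<^sub>m b))"
      using x y n by (simp add: ptd.ptd_add)
  qed
  then show ?case using x y by (intro exI[of _ "\<lambda>n. x n + y n"]) (simp add: sum.distrib)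
qed

lemma ptd_kraus_right:
  fixes N :: nat
  assumes "ptd a b c M"
    and K: "\<And>n. n < N \<Longrightarrow> K n \<in> carrier_mat (e n) b"
    and one: "mat_setsum b b (\<lambda>n. mat_adjoint (K n) * K n) {..<N} = 1\<^sub>m b"
  shows "\<exists>c'. (\<forall>n<N. ptd a (e n) (c' n) ((1\<^sub>m a \<otimes>\<^sub>m K n) * M * mat_adjoint (1\<^sub>m a \<otimes>\<^sub>m K n))) \<and> (\<Sum>n<N. c' n) = c"
  using assms(1)
proof (induction rule: ptd.induct)
  case ptd_zero
  have "\<forall>n<N. ptd a (e n) 0 ((1\<^sub>m a \<otimes>\<^sub>m K n) * 0\<^sub>m (a * b) (a * b) * mat_adjoint (1\<^sub>m a \<otimes>\<^sub>m K n))"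
  proof (intro allI impI)
    fix n assume "n < N"
    then have "1\<^sub>m a \<otimes>\<^sub>m K n \<in> carrier_mat (a * e n) (a * b)" using K[of n] by auto
    from conj_zero[OF this] show "ptd a (e n) 0 ((1\<^sub>m a \<otimes>\<^sub>m K n) * 0\<^sub>m (a * b) (a * b) * mat_adjoint (1\<^sub>m a \<otimes>\<^sub>m K n))"
      by (simp add: ptd.ptd_zero)
  qed
  then show ?case by (intro exI[of _ "\<lambda>_. 0"]) simp
next
  case (ptd_base s W)
  let ?W = "\<lambda>n i k. \<Sum>k'<b. W i k' * cnj (K n $$ (k, k'))"
  have "\<forall>n<N. ptd a (e n) (\<bar>s\<bar> * sqn a (e n) (?W n))
     ((1\<^sub>m a \<otimes>\<^sub>m K n) * (complex_of_real s \<cdot>\<^sub>m ptsq a b W) * mat_adjoint (1\<^sub>m a \<otimes>\<^sub>m K n))"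
  proof (intro allI impI)
    fix n assume "n < N"
    then have "K n \<in> carrier_mat (e n) b" "1\<^sub>m a \<otimes>\<^sub>m K n \<in> carrier_mat (a * e n) (a * b)" using K[of n] by auto
    then show "ptd a (e n) (\<bar>s\<bar> * sqn a (e n) (?W n))
     ((1\<^sub>m a \<otimes>\<^sub>m K n) * (complex_of_real s \<cdot>\<^sub>m ptsq a b W) * mat_adjoint (1\<^sub>m a \<otimes>\<^sub>m K n))"
      by (simp add: conj_smult[of _ _ "a * b"] conj_right_ptsq ptd.ptd_base)
  qed
  moreover have "(\<Sum>n<N. \<bar>s\<bar> * sqn a (e n) (?W n)) = \<bar>s\<bar> * sqn a b W"
    by (simp add: sum_distrib_left[symmetric] sqn_kraus_right[OF K one])
  ultimately show ?case by (intro exI[of _ "\<lambda>n. \<bar>s\<bar> * sqn a (e n) (?W n)"] conjI)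
next
  case (ptd_add c M c' M')
  then obtain x y where
    x: "\<forall>n<N. ptd a (e n) (x n) ((1\<^sub>m a \<otimes>\<^sub>m K n) * M * mat_adjoint (1\<^sub>m a \<otimes>\<^sub>m K n))" "(\<Sum>n<N. x n) = c" and
    y: "\<forall>n<N. ptd a (e n) (y n) ((1\<^sub>m a \<otimes>\<^sub>m K n) * M' * mat_adjoint (1\<^sub>m a \<otimes>\<^sub>m K n))" "(\<Sum>n<N. y n) = c'"
    by blast
  have "\<forall>n<N. ptd a (e n) (x n + y n) ((1\<^sub>m a \<otimes>\<^sub>m K n) * (M + M') * mat_adjoint (1\<^sub>m a \<otimes>\<^sub>m K n))"
  proof (intro allI impI)
    fix n assume n: "n < N"
    then have "1\<^sub>m a \<otimes>\<^sub>m K n \<in> carrier_mat (a * e n) (a * b)" using K[of n] by auto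
    from conj_add[OF this ptd_carrier[OF ptd_add.hyps(1)] ptd_carrier[OF ptd_add.hyps(2)]]
    show "ptd a (e n) (x n + y n) ((1\<^sub>m a \<otimes>\<^sub>m K n) * (M + M') * mat_adjoint (1\<^sub>m a \<otimes>\<^sub>m K n))"
      using x y n by (simp add: ptd.ptd_add)
  qed
  then show ?case using x y by (intro exI[of _ "\<lambda>n. x n + y n"]) (simp add: sum.distrib)
qed

text \<open>Induction on the protocol. One round distributes the weight over its outcomes, the
  remaining protocol keeps each share, and summing the outcomes adds the shares up again.\<close>

lemma locc_ptd: "locc a b a' b' \<Lambda> \<Longrightarrow> ptd a b c M \<Longrightarrow> ptd a' b' c (\<Lambda> M)"
proof (induction arbitrary: c M rule: locc.induct)
  case (locc_id a b)
  then show ?case .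
next
  case (locc_left n K e a b a' b' \<Lambda>)
  obtain c' where c': "\<forall>i<n. ptd (e i) b (c' i) ((K i \<otimes>\<^sub>m 1\<^sub>m b) * M * mat_adjoint (K i \<otimes>\<^sub>m 1\<^sub>m b))" "(\<Sum>i<n. c' i) = c"
    using ptd_kraus_left[OF locc_left.prems locc_left.hyps(1,2)] by blast
  have "ptd a' b' (\<Sum>i<n. c' i) (mat_setsum (a' * b') (a' * b')
         (\<lambda>i. \<Lambda> i ((K i \<otimes>\<^sub>m 1\<^sub>m b) * M * mat_adjoint (K i \<otimes>\<^sub>m 1\<^sub>m b))) {..<n})"
    using c' locc_left.IH by (intro ptd_setsum) auto
  then show ?case using c' by simp
next
  case (locc_right n K e b a a' b' \<Lambda>)
  obtain c' where c': "\<forall>i<n. ptd a (e i) (c' i) ((1\<^sub>m a \<otimes>\<^sub>m K i) * M * mat_adjoint (1\<^sub>m a \<otimes>\<^sub>m K i))" "(\<Sum>i<n. c' i) = c"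
    using ptd_kraus_right[OF locc_right.prems locc_right.hyps(1,2)] by blast
  have "ptd a' b' (\<Sum>i<n. c' i) (mat_setsum (a' * b') (a' * b')
         (\<lambda>i. \<Lambda> i ((1\<^sub>m a \<otimes>\<^sub>m K i) * M * mat_adjoint (1\<^sub>m a \<otimes>\<^sub>m K i))) {..<n})"
    using c' locc_right.IH by (intro ptd_setsum) auto
  then show ?case using c' by simp
qed

section \<open>Decompositions of tensor powers\<close>

lemma entries_bip [simp]:
  "i < a \<Longrightarrow> k < b \<Longrightarrow> j < a \<Longrightarrow> l < b \<Longrightarrow> entries b (bip a b f) i k j l = f i k j l"
  by (simp add: entries_def)

lemma regroup_kron:
  assumes "M \<in> carrier_mat (a * b) (a * b)" "M' \<in> carrier_mat (a' * b') (a' * b')"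
  shows "regroup [a, a', b, b'] [0, 2, 1, 3] (M \<otimes>\<^sub>m M') =
    bip (a * a') (b * b') (tens a' b' (entries b M) (entries b' M'))"
  using regroup_kron_bip[of a a' b b' "entries b M" "entries b' M'"] assms by (simp add: bip_entries)

text \<open>Partial transposition acts factorwise and a product of rank-one operators has rank one,
  with the product vector and the product of the squared norms. Bilinearity becomes a nested
  induction, one over each decomposition.\<close>

lemma ptd_tens:
  assumes "ptd a b c M" "ptd a' b' c' M'"
  shows "ptd (a * a') (b * b') (c * c') (bip (a * a') (b * b') (tens a' b' (entries b M) (entries b' M')))"
  using assms(1)
proof (induction rule: ptd.induct)
  case ptd_zero
  have "bip (a * a') (b * b') (tens a' b' (entries b (0\<^sub>m (a * b) (a * b))) (entries b' M')) = 0\<^sub>m (a * a' * (b * b')) (a * a' * (b * b'))"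
    by (intro eq_matI) (auto simp: bip_index tens_def entries_def div_mod_less pair_index_less)
  then show ?case by (simp add: ptd.ptd_zero)
next
  case (ptd_add c1 M1 c2 M2)
  have "bip (a * a') (b * b') (tens a' b' (entries b (M1 + M2)) (entries b' M')) =
    bip (a * a') (b * b') (tens a' b' (entries b M1) (entries b' M')) +
    bip (a * a') (b * b') (tens a' b' (entries b M2) (entries b' M'))"
    using ptd_carrier[OF ptd_add.hyps(1)] ptd_carrier[OF ptd_add.hyps(2)]
    by (intro eq_matI) (auto simp: bip_index tens_def entries_def div_mod_less pair_index_less distrib_right)
  then show ?case using ptd.ptd_add[OF ptd_add.IH] by (simp add: distrib_right)
next
  case (ptd_base s W)
  show ?case using assms(2)
  proof (induction rule: ptd.induct)
    case ptd_zero
    have "bip (a * a') (b * b') (tens a' b' (entries b (complex_of_real s \<cdot>\<^sub>m ptsq a b W)) (entries b' (0\<^sub>m (a' * b') (a' * b'))))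
      = 0\<^sub>m (a * a' * (b * b')) (a * a' * (b * b'))"
    proof (intro eq_matI, goal_cases)
      case (1 r q)
      \<comment> \<open>The mere existence of an index below the dimension makes the factors
        positive, which the bounds on the \<open>mod\<close> digits require.\<close>
      then have "0 < a'" "0 < b'" by (auto intro!: gr0I)
      with 1 show ?case by (simp add: bip_index tens_def entries_def pair_index_less)
    qed auto
    then show ?case by (simp add: ptd.ptd_zero)
  next
    case (ptd_add c1 M1 c2 M2)
    have "bip (a * a') (b * b') (tens a' b' (entries b (complex_of_real s \<cdot>\<^sub>m ptsq a b W)) (entries b' (M1 + M2))) =
      bip (a * a') (b * b') (tens a' b' (entries b (complex_of_real s \<cdot>\<^sub>m ptsq a b W)) (entries b' M1)) +
      bip (a * a') (b * b') (tens a' b' (entries b (complex_of_real s \<cdot>\<^sub>m ptsq a b W)) (entries b' M2))"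
    proof (intro eq_matI, goal_cases)
      case (1 r q)
      then have "0 < a'" "0 < b'" by (auto intro!: gr0I)
      with 1 show ?case using ptd_carrier[OF ptd_add.hyps(1)] ptd_carrier[OF ptd_add.hyps(2)]
        by (simp add: bip_index tens_def entries_def pair_index_less distrib_left)
    qed auto
    then show ?case using ptd.ptd_add[OF ptd_add.IH] by (simp add: distrib_left)
  next
    case (ptd_base s' W')
    let ?W = "\<lambda>i k. W (i div a') (k div b') * W' (i mod a') (k mod b')"
    have P: "bip (a * a') (b * b') (tens a' b' (entries b (complex_of_real s \<cdot>\<^sub>m ptsq a b W)) (entries b' (complex_of_real s' \<cdot>\<^sub>m ptsq a' b' W')))
      = complex_of_real (s * s') \<cdot>\<^sub>m ptsq (a * a') (b * b') ?W"
      unfolding ptsq_def smult_bip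
    proof (rule bip_cong, goal_cases)
      case (1 i k j l)
      then have "0 < a'" "0 < b'" by (auto intro!: gr0I)
      with 1 show ?case by (simp add: tens_def entries_bip div_mod_less)
    qed
    have Q: "\<bar>s\<bar> * sqn a b W * (\<bar>s'\<bar> * sqn a' b' W') = \<bar>s * s'\<bar> * sqn (a * a') (b * b') ?W"
    proof -
      have "sqn (a * a') (b * b') ?W = (\<Sum>i<a. \<Sum>i'<a'. \<Sum>k<b. \<Sum>k'<b'. (cmod (W i k))\<^sup>2 * (cmod (W' i' k'))\<^sup>2)"
        by (simp add: sqn_def sum_pair_index pair_div_mod norm_mult power_mult_distrib)
      also have "\<dots> = sqn a b W * sqn a' b' W'"
        by (simp add: sqn_def sum_product)
      finally show ?thesis by (simp add: abs_mult)
    qed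
    show ?case unfolding P Q by (rule ptd.ptd_base)
  qed
qed

lemma copies_carrier:
  assumes "M \<in> carrier_mat (a * b) (a * b)"
  shows "copies a b M n \<in> carrier_mat (a ^ n * b ^ n) (a ^ n * b ^ n)"
proof (induction n)
  case (Suc n)
  show ?case using regroup_kron[OF assms Suc] by simp
qed simp

lemma copies_Suc_bip:
  assumes "M \<in> carrier_mat (a * b) (a * b)"
  shows "copies a b M (Suc n) =
    bip (a ^ Suc n) (b ^ Suc n) (tens (a ^ n) (b ^ n) (entries b M) (entries (b ^ n) (copies a b M n)))"
  using regroup_kron[OF assms copies_carrier[OF assms]] by simp

lemma ptd_copies:
  assumes "ptd a b c M"
  shows "ptd (a ^ n) (b ^ n) (c ^ n) (copies a b M n)"
proof (induction n)
  case 0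
  have "ptd 1 1 (\<bar>1\<bar> * sqn 1 1 (\<lambda>_ _. 1)) (complex_of_real 1 \<cdot>\<^sub>m ptsq 1 1 (\<lambda>_ _. 1))" by (rule ptd_base)
  also have "complex_of_real 1 \<cdot>\<^sub>m ptsq 1 1 (\<lambda>_ _. 1) = 1\<^sub>m 1"
    by (intro eq_matI) (auto simp: ptsq_def bip_index)
  finally show ?case by (simp add: sqn_def)
next
  case (Suc n)
  show ?case unfolding copies_Suc_bip[OF ptd_carrier[OF assms]] using ptd_tens[OF assms Suc] by simp
qed

section \<open>Bounds on the distillable entanglement\<close>

lemma bell_state_bip: "bell_state = bip 2 2 (\<lambda>i k j l. if i = k \<and> j = l then 1 / 2 else 0)"
proof (rule eq_matI)
  have amp: "complex_of_real (1 / sqrt 2) * cnj (complex_of_real (1 / sqrt 2)) = 1 / 2"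
    by (simp flip: of_real_mult)
  fix r c assume "r < dim_row (bip 2 2 (\<lambda>i k j l. if i = k \<and> j = l then 1 / 2 else 0 :: complex))"
    "c < dim_col (bip 2 2 (\<lambda>i k j l. if i = k \<and> j = l then 1 / 2 else 0 :: complex))"
  then have "r \<in> {0, 1, 2, 3}" "c \<in> {0, 1, 2, 3}" by auto
  then show "bell_state $$ (r, c) = bip 2 2 (\<lambda>i k j l. if i = k \<and> j = l then 1 / 2 else 0) $$ (r, c)"
    using amp by (auto simp: bell_state_def Let_def outer_def ket_def bip_index unit_vec_def)
qed (simp_all add: bell_state_def Let_def outer_def ket_def)

text \<open>Two numbers below \<open>2 ^ Suc m\<close> agree iff their leading bits and their
  remainders agree. So m Bell pairs, regrouped by party, are one maximally entangled pair of
  dimension \<open>2 ^ m\<close>.\<close>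

lemma copies_bell:
  "copies 2 2 bell_state m = bip (2 ^ m) (2 ^ m) (\<lambda>i k j l. if i = k \<and> j = l then 1 / 2 ^ m else 0)"
proof (induction m)
  case 0
  show ?case by (intro eq_matI) (auto simp: bip_index)
next
  case (Suc m)
  have c: "bell_state \<in> carrier_mat (2 * 2) (2 * 2)" unfolding bell_state_bip by (rule bip_carrier)
  have eq: "i = k \<longleftrightarrow> i div 2 ^ m = k div 2 ^ m \<and> i mod 2 ^ m = k mod 2 ^ m" for i k :: nat
    by (metis div_mult_mod_eq)
  show ?case unfolding copies_Suc_bip[OF c] Suc
  proof (rule bip_cong, goal_cases)
    case (1 i k j l)
    have "i div 2 ^ m < 2" "k div 2 ^ m < 2" "j div 2 ^ m < 2" "l div 2 ^ m < 2"
      using 1 by (simp_all add: less_mult_imp_div_less)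
    then show ?case by (auto simp: tens_def bell_state_bip eq[of i k] eq[of j l])
  qed
qed

lemma mat_trace_mult:
  assumes "A \<in> carrier_mat n n" "B \<in> carrier_mat n n"
  shows "mat_trace (A * B) = (\<Sum>r<n. \<Sum>s<n. A $$ (r, s) * B $$ (s, r))"
  using assms by (auto simp: mat_trace_def scalar_prod_def lessThan_atLeast0 intro!: sum.cong)

lemma mat_trace_bell:
  assumes M: "M \<in> carrier_mat (2 ^ m * 2 ^ m) (2 ^ m * 2 ^ m)"
  shows "mat_trace (copies 2 2 bell_state m * M) =
    (\<Sum>i<2 ^ m. \<Sum>j<2 ^ m. M $$ (j * 2 ^ m + j, i * 2 ^ m + i)) / 2 ^ m"
proof -
  let ?N = "2 ^ m :: nat"
  have "mat_trace (copies 2 2 bell_state m * M) =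
    (\<Sum>i<?N. \<Sum>k<?N. \<Sum>j<?N. \<Sum>l<?N. (if i = k \<and> j = l then 1 / 2 ^ m else 0) * M $$ (j * ?N + l, i * ?N + k))"
    unfolding copies_bell by (subst mat_trace_mult[OF bip_carrier M]) (simp add: sum_pair_index)
  also have "\<dots> = (\<Sum>i<?N. \<Sum>k<?N. if i = k then \<Sum>j<?N. \<Sum>l<?N. if j = l then M $$ (j * ?N + l, i * ?N + k) / 2 ^ m else 0 else 0)"
    by (intro sum.cong refl) (simp add: if_distrib[of "\<lambda>x. x * _"] if_distrib[of "\<lambda>x. \<Sum>_\<in>_. x"] cong: if_cong)
  also have "\<dots> = (\<Sum>i<?N. \<Sum>j<?N. M $$ (j * ?N + j, i * ?N + i) / 2 ^ m)"
    by simp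
  finally show ?thesis by (simp add: sum_divide_distrib)
qed

text \<open>The partial transpose of the target projector is the swap of the two parties divided by
  \<open>2 ^ m\<close>. On a rank-one term the swap has expectation sum of
  \<open>W j i * cnj (W i j)\<close>, which its squared norm bounds; the factor \<open>2 ^ m\<close>
  undoes the normalisation.\<close>

lemma bell_overlap:
  assumes "ptd (2 ^ m) (2 ^ m) c M"
  shows "2 ^ m * Re (mat_trace (copies 2 2 bell_state m * M)) \<le> c"
proof -
  let ?N = "2 ^ m :: nat"
  define t where "t M = Re (\<Sum>i<?N. \<Sum>j<?N. M $$ (j * ?N + j, i * ?N + i))" for M :: "complex mat"
  have "t M \<le> c" using assms
  proof (induction rule: ptd.induct)
    case ptd_zero
    then show ?case by (simp add: t_def pair_index_less)
  next
    case (ptd_add c M c' M')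
    have "t (M + M') = t M + t M'"
      using ptd_carrier[OF ptd_add.hyps(1)] ptd_carrier[OF ptd_add.hyps(2)]
      by (simp add: t_def pair_index_less sum.distrib)
    then show ?case using ptd_add.IH by simp
  next
    case (ptd_base s W)
    have "t (complex_of_real s \<cdot>\<^sub>m ptsq ?N ?N W) = Re (complex_of_real s * (\<Sum>i<?N. \<Sum>j<?N. W j i * cnj (W i j)))"
      unfolding t_def ptsq_def smult_bip by (simp add: sum_distrib_left)
    also have "\<dots> \<le> cmod (complex_of_real s * (\<Sum>i<?N. \<Sum>j<?N. W j i * cnj (W i j)))"
      by (rule complex_Re_le_cmod)
    also have "\<dots> = \<bar>s\<bar> * cmod (\<Sum>i<?N. \<Sum>j<?N. W j i * cnj (W i j))" by (simp add: norm_mult)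
    also have "\<dots> \<le> \<bar>s\<bar> * sqn ?N ?N W"
    proof (rule mult_left_mono)
      \<comment> \<open>Arithmetic-geometric mean for each entry; the transposed sum of squares
        equals the original one, so the halves add up to the squared norm.\<close>
      have "cmod (\<Sum>i<?N. \<Sum>j<?N. W j i * cnj (W i j)) \<le> (\<Sum>i<?N. \<Sum>j<?N. ((cmod (W j i))\<^sup>2 + (cmod (W i j))\<^sup>2) / 2)"
      proof (intro sum_norm_le)
        fix i j
        have "0 \<le> (cmod (W j i) - cmod (W i j))\<^sup>2" by simp
        then show "cmod (W j i * cnj (W i j)) \<le> ((cmod (W j i))\<^sup>2 + (cmod (W i j))\<^sup>2) / 2"
          by (simp add: norm_mult power2_diff)
      qed
      also have "\<dots> = ((\<Sum>i<?N. \<Sum>j<?N. (cmod (W j i))\<^sup>2) + sqn ?N ?N W) / 2"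
        by (simp add: sqn_def sum.distrib sum_divide_distrib[symmetric])
      also have "(\<Sum>i<?N. \<Sum>j<?N. (cmod (W j i))\<^sup>2) = sqn ?N ?N W"
        unfolding sqn_def by (rule sum.swap)
      finally show "cmod (\<Sum>i<?N. \<Sum>j<?N. W j i * cnj (W i j)) \<le> sqn ?N ?N W" by simp
    qed simp
    finally show ?case .
  qed
  moreover have "2 ^ m * Re (mat_trace (copies 2 2 bell_state m * M)) = t M"
  proof -
    have "Re (z / 2 ^ m) = Re z / 2 ^ m" for z
      using Re_divide_of_real[of z "2 ^ m"] by simp
    then show ?thesis
      unfolding mat_trace_bell[OF ptd_carrier[OF assms]] t_def by simp
  qed
  ultimately show ?thesis by simp
qed

lemma distillable_entanglement_le:
  assumes \<rho>: "ptd a b c \<rho>" and c: "c > 0"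
  shows "distillable_entanglement a b \<rho> \<le> ereal (log 2 c)"
  unfolding distillable_entanglement_def
proof (rule SUP_least)
  fix R assume "R \<in> {R. achievable_rate a b \<rho> R}"
  then obtain m \<Lambda> where L: "\<And>n. locc (a ^ n) (b ^ n) (2 ^ m n) (2 ^ m n) (\<Lambda> n)"
    and lim: "(\<lambda>n. real (m n) / real n) \<longlonglongrightarrow> R"
    and fid: "(\<lambda>n. mat_trace (copies 2 2 bell_state (m n) * \<Lambda> n (copies a b \<rho> n))) \<longlonglongrightarrow> 1"
    by (auto simp: achievable_rate_def)
  let ?F = "\<lambda>n. Re (mat_trace (copies 2 2 bell_state (m n) * \<Lambda> n (copies a b \<rho> n)))"
  have bound: "2 ^ m n * ?F n \<le> c ^ n" for n
    by (intro bell_overlap locc_ptd[OF L] ptd_copies \<rho>)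
  have "?F \<longlonglongrightarrow> 1" using tendsto_Re[OF fid] by simp
  \<comment> \<open>Any threshold strictly between 0 and 1 would do. It costs a constant factor,
    here 2, which turns into the vanishing term 1 / n of the rate.\<close>
  then have "eventually (\<lambda>n. ?F n > 1 / 2) sequentially" by (rule order_tendstoD) simp
  then have "eventually (\<lambda>n. real (m n) / real n \<le> 1 / real n + log 2 c) sequentially"
    using eventually_gt_at_top[of 0]
  proof eventually_elim
    case (elim n)
    have "2 ^ m n * (1 / 2) \<le> 2 ^ m n * ?F n" using elim by (intro mult_left_mono) auto
    also note bound
    finally have "2 ^ m n \<le> 2 * c ^ n" by simp
    then have "log 2 (2 ^ m n) \<le> log 2 (2 * c ^ n)" using c by (subst log_le_cancel_iff) auto
    also have "log 2 (2 * c ^ n) = 1 + real n * log 2 c" using c by (simp add: log_mult log_nat_power)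
    finally have "real (m n) \<le> 1 + real n * log 2 c" by (simp add: log_nat_power)
    then show ?case using elim by (simp add: field_simps)
  qed
  moreover have "(\<lambda>n. 1 / real n + log 2 c) \<longlonglongrightarrow> 0 + log 2 c"
    by (intro tendsto_intros lim_1_over_n)
  ultimately have "R \<le> 0 + log 2 c" using lim by (intro tendsto_le[OF sequentially_bot]) auto
  then show "ereal R \<le> ereal (log 2 c)" by simp
qed

section \<open>Rate zero is achievable\<close>

lemma mat_trace_bip: "mat_trace (bip a b f) = (\<Sum>i<a. \<Sum>k<b. f i k i k)"
  by (simp add: mat_trace_def sum_pair_index)

lemma mat_trace_entries:
  "M \<in> carrier_mat (a * b) (a * b) \<Longrightarrow> mat_trace M = (\<Sum>i<a. \<Sum>k<b. entries b M i k i k)"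
  by (subst bip_entries[symmetric], assumption) (rule mat_trace_bip)

lemma mat_trace_copies:
  assumes "M \<in> carrier_mat (a * b) (a * b)"
  shows "mat_trace (copies a b M n) = mat_trace M ^ n"
proof (induction n)
  case 0
  show ?case by (simp add: mat_trace_def)
next
  case (Suc n)
  have "mat_trace (copies a b M (Suc n)) = 
    (\<Sum>i<a. \<Sum>i'<a ^ n. \<Sum>k<b. \<Sum>k'<b ^ n. entries b M i k i k * entries (b ^ n) (copies a b M n) i' k' i' k')"
    unfolding copies_Suc_bip[OF assms] mat_trace_bip
    by (simp add: sum_pair_index tens_def pair_div_mod)
  also have "\<dots> = (\<Sum>i<a. \<Sum>k<b. entries b M i k i k) *
     (\<Sum>i'<a ^ n. \<Sum>k'<b ^ n. entries (b ^ n) (copies a b M n) i' k' i' k')"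
    by (simp add: sum_product)
  also have "\<dots> = mat_trace M ^ Suc n"
    using Suc mat_trace_entries[OF assms] mat_trace_entries[OF copies_carrier[OF assms]] by simp
  finally show ?case .
qed

text \<open>The row vector <i| as a Kraus operator: it measures in the standard basis and leaves a
  one-dimensional system, that is, discards the input.\<close>

definition bra :: "nat \<Rightarrow> nat \<Rightarrow> complex mat" where
  "bra n i = mat 1 n (\<lambda>(r, c). if c = i then 1 else 0)"

lemma bra_carrier: "bra n i \<in> carrier_mat 1 n"
  by (simp add: bra_def)

lemma bra_complete: "mat_setsum n n (\<lambda>i. mat_adjoint (bra n i) * bra n i) {..<n} = 1\<^sub>m n"
proof (intro eq_matI, goal_cases)
  case (1 r c)
  then have rc: "r < n" "c < n" by simp_all
  have "mat_setsum n n (\<lambda>i. mat_adjoint (bra n i) * bra n i) {..<n} $$ (r, c) =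
    (\<Sum>i<n. if i = r then (if c = i then 1 else 0) else 0)"
    using rc by (simp add: bra_def scalar_prod_def if_distrib cong: if_cong) (auto intro!: sum.cong)
  then show ?case using rc by auto
qed auto

text \<open>The outcomes of the basis measurement are added, which is the partial trace over the
  second party. The action is specified on matrices \<open>bip 1 b f\<close> only, since nothing
  else is fed in.\<close>

lemma locc_trace_right:
  "\<exists>\<Lambda>. locc 1 b 1 1 \<Lambda> \<and> (\<forall>f. \<Lambda> (bip 1 b f) = bip 1 1 (\<lambda>_ _ _ _. \<Sum>k<b. f 0 k 0 k))"
proof -
  let ?L = "\<lambda>X. mat_setsum (1 * 1) (1 * 1)
         (\<lambda>k. (1\<^sub>m 1 \<otimes>\<^sub>m bra b k) * X * mat_adjoint (1\<^sub>m 1 \<otimes>\<^sub>m bra b k)) {..<b}"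
  have "locc 1 b 1 1 ?L"
    by (rule locc_right[where e = "\<lambda>_. 1" and \<Lambda> = "\<lambda>_ X. X"]) (use bra_carrier in \<open>simp_all add: locc_id bra_complete\<close>)
  moreover have "?L (bip 1 b f) = bip 1 1 (\<lambda>_ _ _ _. \<Sum>k<b. f 0 k 0 k)" for f
  proof (intro eq_matI, goal_cases)
    case (1 r c)
    have e: "(\<Sum>k'<b. \<Sum>l'<b. bra b k $$ (0, k') * f 0 k' 0 l' * cnj (bra b k $$ (0, l'))) = f 0 k 0 k"
      if "k < b" for k
    proof -
      have "(\<Sum>k'<b. \<Sum>l'<b. bra b k $$ (0, k') * f 0 k' 0 l' * cnj (bra b k $$ (0, l'))) =
        (\<Sum>k'<b. if k' = k then \<Sum>l'<b. if l' = k then f 0 k' 0 l' else 0 else 0)"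
        by (intro sum.cong refl) (auto simp: bra_def if_distrib[of cnj] if_distrib[of "\<lambda>x. _ * x"] cong: if_cong)
      then show ?thesis using that by simp
    qed
    from 1 show ?case
      by (simp add: conj_right[OF bra_carrier] bip_index e)
  qed auto
  ultimately show ?thesis by blast
qed

lemma locc_trace:
  "\<exists>\<Lambda>. locc a b 1 1 \<Lambda> \<and> (\<forall>f. \<Lambda> (bip a b f) = bip 1 1 (\<lambda>_ _ _ _. \<Sum>i<a. \<Sum>k<b. f i k i k))"
proof -
  obtain \<Lambda> where L: "locc 1 b 1 1 \<Lambda>" "\<And>f. \<Lambda> (bip 1 b f) = bip 1 1 (\<lambda>_ _ _ _. \<Sum>k<b. f 0 k 0 k)"
    using locc_trace_right by blast
  let ?L = "\<lambda>X. mat_setsum (1 * 1) (1 * 1)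
         (\<lambda>i. \<Lambda> ((bra a i \<otimes>\<^sub>m 1\<^sub>m b) * X * mat_adjoint (bra a i \<otimes>\<^sub>m 1\<^sub>m b))) {..<a}"
  have "locc a b 1 1 ?L"
    by (rule locc_left[where e = "\<lambda>_. 1" and \<Lambda> = "\<lambda>_. \<Lambda>"]) (use L(1) bra_carrier in \<open>simp_all add: bra_complete\<close>)
  moreover have "?L (bip a b f) = bip 1 1 (\<lambda>_ _ _ _. \<Sum>i<a. \<Sum>k<b. f i k i k)" for f
  proof (intro eq_matI, goal_cases)
    case (1 r c)
    have e: "(\<Sum>i'<a. \<Sum>j'<a. bra a i $$ (0, i') * f i' k j' k * cnj (bra a i $$ (0, j'))) = f i k i k"
      if "i < a" for i k
    proof -
      have "(\<Sum>i'<a. \<Sum>j'<a. bra a i $$ (0, i') * f i' k j' k * cnj (bra a i $$ (0, j'))) =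
        (\<Sum>i'<a. if i' = i then \<Sum>j'<a. if j' = i then f i' k j' k else 0 else 0)"
        by (intro sum.cong refl) (auto simp: bra_def if_distrib[of cnj] if_distrib[of "\<lambda>x. _ * x"] cong: if_cong)
      then show ?thesis using that by simp
    qed
    from 1 show ?case
      by (simp add: conj_left[OF bra_carrier] L(2)[unfolded One_nat_def] bip_index e)
  qed auto
  ultimately show ?thesis by blast
qed

text \<open>For m = 0 the target is the 1 by 1 identity, so the fidelity is the trace of the output.
  Discarding both systems keeps the trace at 1 for every n.\<close>

lemma achievable_rate_0:
  assumes \<rho>: "\<rho> \<in> carrier_mat (a * b) (a * b)" and tr: "mat_trace \<rho> = 1"
  shows "achievable_rate a b \<rho> 0"
proof -
  have "\<forall>n. \<exists>\<Lambda>. locc (a ^ n) (b ^ n) 1 1 \<Lambda> \<and>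
    (\<forall>f. \<Lambda> (bip (a ^ n) (b ^ n) f) = bip 1 1 (\<lambda>_ _ _ _. \<Sum>i<a ^ n. \<Sum>k<b ^ n. f i k i k))"
    by (intro allI locc_trace)
  note choice[OF this]
  then obtain \<Lambda> where L: "\<And>n. locc (a ^ n) (b ^ n) 1 1 (\<Lambda> n)"
    "\<And>n f. \<Lambda> n (bip (a ^ n) (b ^ n) f) = bip 1 1 (\<lambda>_ _ _ _. \<Sum>i<a ^ n. \<Sum>k<b ^ n. f i k i k)"
    by blast
  have "mat_trace (copies 2 2 bell_state 0 * \<Lambda> n (copies a b \<rho> n)) = 1" for n
  proof -
    have "\<Lambda> n (copies a b \<rho> n) = bip 1 1 (\<lambda>_ _ _ _. 1)"
      using L(2)[of n "entries (b ^ n) (copies a b \<rho> n)"] copies_carrier[OF \<rho>, of n]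
        mat_trace_copies[OF \<rho>, of n] mat_trace_entries[OF copies_carrier[OF \<rho>], of n]
      by (simp add: bip_entries tr)
    then show ?thesis by (simp add: mat_trace_def bip_def)
  qed
  then show ?thesis unfolding achievable_rate_def using L(1)
    by (intro exI[of _ "\<lambda>_. 0"] exI[of _ \<Lambda>]) simp
qed

text \<open>This excludes the value minus infinity of an empty supremum and supplies the lower half
  of the squeeze to 0.\<close>

lemma distillable_entanglement_nonneg:
  assumes "\<rho> \<in> carrier_mat (a * b) (a * b)" and "mat_trace \<rho> = 1"
  shows "0 \<le> distillable_entanglement a b \<rho>"
  unfolding distillable_entanglement_def
  by (rule SUP_upper2[of 0]) (use achievable_rate_0[OF assms] in \<open>auto simp: zero_ereal_def\<close>)

section \<open>Tensor products, positivity and the flip operator\<close>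

lemma kron_mult:
  fixes A B C D :: "'a::comm_semiring_0 mat"
  assumes "A \<in> carrier_mat m n" "B \<in> carrier_mat n p" "C \<in> carrier_mat m' n'" "D \<in> carrier_mat n' p'"
  shows "(A \<otimes>\<^sub>m C) * (B \<otimes>\<^sub>m D) = (A * B) \<otimes>\<^sub>m (C * D)"
proof (intro eq_matI, goal_cases)
  case (1 r c)
  then have r: "r < m * m'" "c < p * p'" using assms by auto
  note d = div_mod_less[OF r(1)] div_mod_less[OF r(2)]
  have "((A \<otimes>\<^sub>m C) * (B \<otimes>\<^sub>m D)) $$ (r, c) = (\<Sum>t<n * n'. (A \<otimes>\<^sub>m C) $$ (r, t) * (B \<otimes>\<^sub>m D) $$ (t, c))"
    using r assms by (auto simp: scalar_prod_def lessThan_atLeast0 intro!: sum.cong)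
  also have "\<dots> = (\<Sum>i<n. \<Sum>k<n'. (A $$ (r div m', i) * B $$ (i, c div p')) * (C $$ (r mod m', k) * D $$ (k, c mod p')))"
    unfolding sum_pair_index using r assms
    by (intro sum.cong refl) (auto simp: kron_index pair_index_less pair_div_mod mult_ac)
  also have "\<dots> = (A * B) $$ (r div m', c div p') * (C * D) $$ (r mod m', c mod p')"
    using d assms by (simp add: scalar_prod_def sum_product lessThan_atLeast0)
  also have "\<dots> = ((A * B) \<otimes>\<^sub>m (C * D)) $$ (r, c)"
    using r assms by (simp add: kron_index)
  finally show ?case .
qed (use assms in auto)

lemma kron_adjoint: "mat_adjoint (A \<otimes>\<^sub>m B) = mat_adjoint A \<otimes>\<^sub>m mat_adjoint (B :: complex mat)"
  by (intro eq_matI) (auto simp: kron_index div_mod_less)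

lemma kron_add_left:
  "A \<in> carrier_mat m n \<Longrightarrow> B \<in> carrier_mat m n \<Longrightarrow> (A + B) \<otimes>\<^sub>m C = A \<otimes>\<^sub>m C + B \<otimes>\<^sub>m C"
  by (intro eq_matI) (auto simp: kron_index div_mod_less distrib_right)

lemma kron_one: "1\<^sub>m m \<otimes>\<^sub>m 1\<^sub>m n = (1\<^sub>m (m * n) :: 'a::semiring_1 mat)"
proof (intro eq_matI, goal_cases)
  case (1 r c)
  have "r = c \<longleftrightarrow> r div n = c div n \<and> r mod n = c mod n" by (metis div_mult_mod_eq)
  then show ?case using 1 by (auto simp: kron_index div_mod_less)
qed auto

lemma mat_trace_kron:
  "M \<in> carrier_mat m m \<Longrightarrow> N \<in> carrier_mat n n \<Longrightarrow> mat_trace (M \<otimes>\<^sub>m N) = mat_trace M * (mat_trace N :: 'a::comm_semiring_0)"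
  by (auto simp: mat_trace_def sum_pair_index kron_index pair_index_less pair_div_mod sum_product)

lemma mat_trace_add:
  "M \<in> carrier_mat n n \<Longrightarrow> N \<in> carrier_mat n n \<Longrightarrow> mat_trace (M + N) = mat_trace M + mat_trace N"
  by (auto simp: mat_trace_def sum.distrib)

lemma mat_trace_smult:
  "M \<in> carrier_mat n n \<Longrightarrow> mat_trace (c \<cdot>\<^sub>m M) = (c :: 'a::semiring_0) * mat_trace M"
  by (auto simp: mat_trace_def sum_distrib_left)

text \<open>Positivity with an explicit factor. Tensor products and nonnegative multiples of such
  matrices inherit a factor at once, whereas sums are handled by the quadratic form of
  \<open>psd\<close>; hence two predicates, linked in the one direction that is used.\<close>

definition gram :: "nat \<Rightarrow> complex mat \<Rightarrow> bool" where
  "gram n M \<longleftrightarrow> (\<exists>m N. N \<in> carrier_mat n m \<and> M = N * mat_adjoint N)"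

definition psd :: "nat \<Rightarrow> complex mat \<Rightarrow> bool" where
  "psd n M \<longleftrightarrow> M \<in> carrier_mat n n \<and> (\<forall>v\<in>carrier_vec n. 0 \<le> (M *\<^sub>v v) \<bullet>c v)"

lemma gramI: "N \<in> carrier_mat n m \<Longrightarrow> gram n (N * mat_adjoint N)"
  by (auto simp: gram_def)

lemma gram_kron:
  assumes "gram m M" "gram n N"
  shows "gram (m * n) (M \<otimes>\<^sub>m N)"
proof -
  obtain p q A B where A: "A \<in> carrier_mat m p" "M = A * mat_adjoint A"
    and B: "B \<in> carrier_mat n q" "N = B * mat_adjoint B"
    using assms by (auto simp: gram_def)
  have "M \<otimes>\<^sub>m N = (A \<otimes>\<^sub>m B) * mat_adjoint (A \<otimes>\<^sub>m B)"
    unfolding A(2) B(2) kron_adjoint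
    using kron_mult[OF A(1) mat_adjoint_carrier[OF A(1)] B(1) mat_adjoint_carrier[OF B(1)]] by simp
  moreover have "A \<otimes>\<^sub>m B \<in> carrier_mat (m * n) (p * q)" using A B by auto
  ultimately show ?thesis by (metis gramI)
qed

lemma gram_smult:
  assumes "gram n M" "c \<ge> 0"
  shows "gram n (complex_of_real c \<cdot>\<^sub>m M)"
proof -
  obtain m N where N: "N \<in> carrier_mat n m" "M = N * mat_adjoint N"
    using assms by (auto simp: gram_def)
  let ?s = "complex_of_real (sqrt c)"
  have s: "?s * ?s = complex_of_real c" using assms(2) by (simp flip: of_real_mult)
  have "complex_of_real c \<cdot>\<^sub>m M = (?s \<cdot>\<^sub>m N) * mat_adjoint (?s \<cdot>\<^sub>m N)"
  proof (intro eq_matI, goal_cases)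
    case (1 i j)
    then have "i < n" "j < n" using N by auto
    then show ?case using N
      by (simp add: scalar_prod_def sum_distrib_left s[symmetric] mult_ac)
  qed (use N in auto)
  moreover have "?s \<cdot>\<^sub>m N \<in> carrier_mat n m" using N by simp
  ultimately show ?thesis unfolding N(2) by (metis gramI)
qed

lemma gram_outer:
  assumes "v \<in> carrier_vec n"
  shows "gram n (outer v v)"
proof -
  have "outer v v = mat n 1 (\<lambda>(i, _). v $ i) * mat_adjoint (mat n 1 (\<lambda>(i, _). v $ i))"
    using assms by (intro eq_matI) (auto simp: outer_def scalar_prod_def)
  then show ?thesis using gramI[of "mat n 1 (\<lambda>(i, _). v $ i)" n 1] by simp
qed

lemma quadratic_form:
  assumes "M \<in> carrier_mat n n" "v \<in> carrier_vec n"
  shows "(M *\<^sub>v v) \<bullet>c v = (\<Sum>r<n. \<Sum>s<n. M $$ (r, s) * v $ s * cnj (v $ r))"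
  using assms by (auto simp: scalar_prod_def sum_distrib_right lessThan_atLeast0 intro!: sum.cong)

lemma gram_psd:
  assumes "gram n M"
  shows "psd n M"
proof -
  obtain m N where N: "N \<in> carrier_mat n m" "M = N * mat_adjoint N"
    using assms by (auto simp: gram_def)
  have M: "M \<in> carrier_mat n n" using N mat_adjoint_carrier[OF N(1)] by simp
  have "0 \<le> (M *\<^sub>v v) \<bullet>c v" if v: "v \<in> carrier_vec n" for v
  proof -
    have "(M *\<^sub>v v) \<bullet>c v = (\<Sum>r<n. \<Sum>s<n. \<Sum>t<m. N $$ (r, t) * cnj (N $$ (s, t)) * v $ s * cnj (v $ r))"
      unfolding quadratic_form[OF M v] using N
      by (intro sum.cong refl) (simp add: scalar_prod_def sum_distrib_right lessThan_atLeast0)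
    also have "\<dots> = (\<Sum>t<m. \<Sum>r<n. \<Sum>s<n. N $$ (r, t) * cnj (N $$ (s, t)) * v $ s * cnj (v $ r))"
    proof -
      have "(\<Sum>r<n. \<Sum>s<n. \<Sum>t<m. N $$ (r, t) * cnj (N $$ (s, t)) * v $ s * cnj (v $ r)) =
        (\<Sum>r<n. \<Sum>t<m. \<Sum>s<n. N $$ (r, t) * cnj (N $$ (s, t)) * v $ s * cnj (v $ r))"
        by (intro sum.cong[OF refl] sum.swap)
      then show ?thesis by (simp only: sum.swap[of _ "{..<m}" "{..<n}"])
    qed
    also have "\<dots> = (\<Sum>t<m. cnj (\<Sum>s<n. cnj (N $$ (s, t)) * v $ s) * (\<Sum>s<n. cnj (N $$ (s, t)) * v $ s))"
      by (simp only: cnj_sum sum_product) (simp add: mult_ac)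
    also have "\<dots> = complex_of_real (\<Sum>t<m. (cmod (\<Sum>s<n. cnj (N $$ (s, t)) * v $ s))\<^sup>2)"
      by (simp only: of_real_sum complex_norm_square mult.commute)
    \<comment> \<open>The order on complex numbers compares real parts and demands equal imaginary
      parts, so the form first had to be exhibited as a real number.\<close>
    finally show ?thesis
      by (simp only: less_eq_complex_def Re_complex_of_real Im_complex_of_real) (simp add: sum_nonneg)
  qed
  then show ?thesis using M by (simp add: psd_def)
qed

lemma psd_add: "psd n M \<Longrightarrow> psd n N \<Longrightarrow> psd n (M + N)"
  by (auto simp: psd_def add_mult_distrib_mat_vec[of _ n n] add_scalar_prod_distrib[of _ n])

lemma density_operator_iff: "density_operator n M \<longleftrightarrow> psd n M \<and> mat_trace M = 1"
  by (auto simp: density_operator_def psd_def)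

section \<open>The flip operator and the states on its two eigenspaces\<close>

lemma pair_index_eq:
  fixes p q i j d :: nat
  assumes "q < d" "j < d"
  shows "p * d + q = i * d + j \<longleftrightarrow> p = i \<and> q = j"
  using assms by (metis pair_div_mod)

lemma flip_op_bip: "flip_op d = bip d d (\<lambda>p q p' q'. if p = q' \<and> q = p' then 1 else 0)"
proof (rule eq_bipI)
  show "flip_op d \<in> carrier_mat (d * d) (d * d)" by (simp add: flip_op_def)
  fix p q p' q' assume b: "p < d" "q < d" "p' < d" "q' < d"
  have "flip_op d $$ (p * d + q, p' * d + q') = (\<Sum>i<d. \<Sum>j<d. if i = p \<and> j = q \<and> j = p' \<and> i = q' then 1 else 0)"
    using b by (auto simp: flip_op_def pair_index_less sum.cartesian_product outer_def ket_def
        unit_vec_def pair_index_eq intro!: sum.cong)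
  also have "\<dots> = (\<Sum>i<d. if i = p then \<Sum>j<d. if j = q then (if p = q' \<and> q = p' then 1 else 0) else 0 else 0)"
    by (intro sum.cong refl) (auto intro!: sum.cong)
  also have "\<dots> = (if p = q' \<and> q = p' then 1 else 0)" using b by simp
  finally show "flip_op d $$ (p * d + q, p' * d + q') = (if p = q' \<and> q = p' then 1 else 0)" .
qed

lemma one_bip: "1\<^sub>m (a * b) = bip a b (\<lambda>p q p' q'. if p = p' \<and> q = q' then 1 else 0)"
  by (rule eq_bipI) (auto simp: pair_index_less pair_index_eq)

lemma flip_op_carrier [simp]: "flip_op d \<in> carrier_mat (d * d) (d * d)"
  by (simp add: flip_op_bip)

lemma flip_op_adjoint: "mat_adjoint (flip_op d) = flip_op d"
  by (intro eq_matI) (auto simp: flip_op_bip bip_index)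

lemma flip_op_square: "flip_op d * flip_op d = 1\<^sub>m (d * d)"
  unfolding one_bip
proof (rule eq_bipI)
  show "flip_op d * flip_op d \<in> carrier_mat (d * d) (d * d)"
    by (rule mult_carrier_mat[OF flip_op_carrier flip_op_carrier])
  fix p q p' q' assume b: "p < d" "q < d" "p' < d" "q' < d"
  have "(flip_op d * flip_op d) $$ (p * d + q, p' * d + q') =
    (\<Sum>t<d * d. flip_op d $$ (p * d + q, t) * flip_op d $$ (t, p' * d + q'))"
    using b carrier_matD[OF flip_op_carrier[of d]]
    by (simp add: scalar_prod_def pair_index_less lessThan_atLeast0)
  also have "\<dots> = (\<Sum>i<d. \<Sum>j<d. if i = q then if j = p then (if p = p' \<and> q = q' then 1 else 0) else 0 else 0)"
    unfolding sum_pair_index using b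
    by (intro sum.cong refl) (auto simp: flip_op_bip)
  also have "\<dots> = (\<Sum>i<d. if i = q then \<Sum>j<d. if j = p then (if p = p' \<and> q = q' then 1 else 0) else 0 else 0)"
    by (intro sum.cong refl) simp
  also have "\<dots> = (if p = p' \<and> q = q' then 1 else 0)" using b by simp
  finally show "(flip_op d * flip_op d) $$ (p * d + q, p' * d + q') = (if p = p' \<and> q = q' then 1 else 0)" .
qed

lemma rho_s_carrier [simp]: "rho_s d \<in> carrier_mat (d * d) (d * d)"
  by (simp add: rho_s_def)

lemma rho_a_carrier [simp]: "rho_a d \<in> carrier_mat (d * d) (d * d)"
  unfolding rho_a_def using flip_op_carrier[of d] by (intro smult_carrier_mat minus_carrier_mat)

text \<open>From F^2 = 1 one gets F(1 + F) = 1 + F: the symmetric state lives on the eigenspace +1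
  of the flip, and likewise the antisymmetric one on the eigenspace -1.\<close>

lemma flip_rho_s: "flip_op d * rho_s d = rho_s d" "rho_s d * flip_op d = rho_s d"
proof -
  note F = flip_op_carrier[of d]
  have "flip_op d * (1\<^sub>m (d * d) + flip_op d) = 1\<^sub>m (d * d) + flip_op d"
    "(1\<^sub>m (d * d) + flip_op d) * flip_op d = 1\<^sub>m (d * d) + flip_op d"
    using F by (simp_all add: mult_add_distrib_mat[OF F _ F] add_mult_distrib_mat[OF _ F F] flip_op_square left_mult_one_mat[OF F] right_mult_one_mat[OF F] comm_add_mat[OF F one_carrier_mat])
  moreover have N: "1\<^sub>m (d * d) + flip_op d \<in> carrier_mat (d * d) (d * d)" using F by simp
  ultimately show "flip_op d * rho_s d = rho_s d" "rho_s d * flip_op d = rho_s d"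
    by (simp_all add: rho_s_def mult_smult_distrib[OF F N] mult_smult_assoc_mat[OF N F])
qed

lemma flip_rho_a: "flip_op d * rho_a d = - rho_a d" "rho_a d * flip_op d = - rho_a d"
proof -
  note F = flip_op_carrier[of d]
  have "flip_op d * (1\<^sub>m (d * d) - flip_op d) = - (1\<^sub>m (d * d) - flip_op d)"
    "(1\<^sub>m (d * d) - flip_op d) * flip_op d = - (1\<^sub>m (d * d) - flip_op d)"
    using F by (simp_all add: mult_minus_distrib_mat[OF F _ F] minus_mult_distrib_mat[OF _ F F] flip_op_square
        left_mult_one_mat[OF F] right_mult_one_mat[OF F])
      (use carrier_matD[OF F] in \<open>auto intro!: eq_matI\<close>)
  moreover have "c \<cdot>\<^sub>m (- M) = - (c \<cdot>\<^sub>m M)" for c :: complex and M by (auto intro!: eq_matI)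
  moreover have "1\<^sub>m (d * d) - flip_op d \<in> carrier_mat (d * d) (d * d)" by (rule minus_carrier_mat[OF F])
  ultimately show "flip_op d * rho_a d = - rho_a d" "rho_a d * flip_op d = - rho_a d"
    by (simp_all add: rho_a_def mult_smult_distrib[OF F] mult_smult_assoc_mat[OF _ F])
qed

lemma real_coefficient_s: "1 / ((of_nat d)\<^sup>2 + of_nat d) = complex_of_real (1 / ((real d)\<^sup>2 + real d))"
  by simp

lemma real_coefficient_a: "1 / ((of_nat d)\<^sup>2 - of_nat d) = complex_of_real (1 / ((real d)\<^sup>2 - real d))"
  by simp

lemma smult_smult: "a \<cdot>\<^sub>m (b \<cdot>\<^sub>m M) = (a * b :: 'a::semigroup_mult) \<cdot>\<^sub>m M"
  by (intro eq_matI) (auto simp: mult.assoc)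

lemma of_real_inverse_double: "complex_of_real (1 / (2 * t)) * 2 = complex_of_real (1 / t)"
  by simp

lemma one_adjoint: "mat_adjoint (1\<^sub>m n) = (1\<^sub>m n :: complex mat)"
  by (auto intro!: eq_matI)

text \<open>1 + F is Hermitian and twice a projector, so it is its own factor up to the scalar 2;
  this is the 2 in the denominator below.\<close>

lemma gram_rho_s: "gram (d * d) (rho_s d)"
proof -
  note F = flip_op_carrier[of d]
  let ?N = "1\<^sub>m (d * d) + flip_op d"
  have N: "?N \<in> carrier_mat (d * d) (d * d)" using F by simp
  have "mat_adjoint ?N = ?N"
    by (intro eq_matI) (auto simp: flip_op_bip bip_index)
  then have sq: "?N * mat_adjoint ?N = 2 \<cdot>\<^sub>m ?N"
    using F by (simp add: mult_add_distrib_mat[OF N _ F] add_mult_distrib_mat[OF _ F F] flip_op_square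
        left_mult_one_mat[OF F] right_mult_one_mat[OF N])
     (use carrier_matD[OF F] in \<open>auto intro!: eq_matI\<close>)
  have eq: "rho_s d = complex_of_real (1 / (2 * ((real d)\<^sup>2 + real d))) \<cdot>\<^sub>m (?N * mat_adjoint ?N)"
    unfolding sq rho_s_def real_coefficient_s smult_smult of_real_inverse_double ..
  show ?thesis unfolding eq by (intro gram_smult gramI[OF N]) simp
qed

lemma gram_rho_a: "gram (d * d) (rho_a d)"
proof -
  note F = flip_op_carrier[of d]
  let ?N = "1\<^sub>m (d * d) - flip_op d"
  have N: "?N \<in> carrier_mat (d * d) (d * d)" by (rule minus_carrier_mat[OF F])
  have "mat_adjoint ?N = ?N"
    by (intro eq_matI) (auto simp: flip_op_bip bip_index)
  then have sq: "?N * mat_adjoint ?N = 2 \<cdot>\<^sub>m ?N"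
    using F N by (simp add: mult_minus_distrib_mat[OF N _ F] minus_mult_distrib_mat[OF _ F F] flip_op_square
        left_mult_one_mat[OF F] right_mult_one_mat[OF N])
     (use carrier_matD[OF F] in \<open>auto intro!: eq_matI\<close>)
  have eq: "rho_a d = complex_of_real (1 / (2 * ((real d)\<^sup>2 - real d))) \<cdot>\<^sub>m (?N * mat_adjoint ?N)"
    unfolding sq rho_a_def real_coefficient_a smult_smult of_real_inverse_double ..
  \<comment> \<open>For d = 0 and d = 1 the denominator vanishes and the quotient is 0 by
    convention, so no bound on d is needed here.\<close>
  have "0 \<le> 1 / (2 * ((real d)\<^sup>2 - real d))" 
    by (cases d) (auto simp: power2_eq_square field_simps)
  then show ?thesis unfolding eq by (intro gram_smult gramI[OF N])
qed

lemma mat_trace_flip_op: "mat_trace (flip_op d) = of_nat d"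
proof -
  have "mat_trace (flip_op d) = (\<Sum>i<d. \<Sum>k<d. if i = k then 1 else 0)"
  proof -
    have "(if i = k \<and> k = i then 1 else 0 :: complex) = (if i = k then 1 else 0)" for i k :: nat by auto
    then show ?thesis unfolding flip_op_bip mat_trace_def by (simp add: sum_pair_index)
  qed
  then show ?thesis by simp
qed

lemma mat_trace_one: "mat_trace (1\<^sub>m n) = (of_nat n :: 'a::semiring_1)"
  by (simp add: mat_trace_def)

lemma mat_trace_rho_s:
  assumes "d \<ge> 1"
  shows "mat_trace (rho_s d) = 1"
proof -
  have "(of_nat d)\<^sup>2 + of_nat d = (of_nat (d * d + d) :: complex)" by (simp add: power2_eq_square)
  moreover have "(of_nat (d * d + d) :: complex) \<noteq> 0" using assms unfolding of_nat_eq_0_iff by simp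
  ultimately show ?thesis
    by (simp add: rho_s_def mat_trace_smult[of _ "d * d"] mat_trace_add[of _ "d * d"] mat_trace_flip_op mat_trace_one)
qed

lemma mat_trace_rho_a:
  assumes "d \<ge> 2"
  shows "mat_trace (rho_a d) = 1"
proof -
  note F = flip_op_carrier[of d]
  have nz: "(of_nat d)\<^sup>2 - of_nat d \<noteq> (0 :: complex)"
    using assms by (simp add: power2_eq_square)
  have "mat_trace (1\<^sub>m (d * d) - flip_op d) = (of_nat d)\<^sup>2 - of_nat d"
    using mat_trace_flip_op[of d] carrier_matD[OF F]
    by (simp add: mat_trace_def sum_subtractf power2_eq_square)
  with nz show ?thesis
    by (simp add: rho_a_def mat_trace_smult[OF minus_carrier_mat[OF F]])
qed

section \<open>The secret-sharing form\<close>

text \<open>diag(x, y) on C'. It serves as the basis projectors, as the Pauli matrix Z and as the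
  distribution (a1, a2).\<close>

definition weight :: "complex \<Rightarrow> complex \<Rightarrow> complex mat" where
  "weight x y = mat 2 2 (\<lambda>(r, c). if r = c then if r = 0 then x else y else 0)"

lemma weight_carrier [simp]: "weight x y \<in> carrier_mat 2 2"
  by (simp add: weight_def)

lemma weight_mult: "weight x y * weight x' y' = weight (x * x') (y * y')"
  by (intro eq_matI) (auto simp: weight_def scalar_prod_def numeral_2_eq_2 less_Suc_eq)

lemma weight_adjoint: "mat_adjoint (weight x y) = weight (cnj x) (cnj y)"
  by (intro eq_matI) (auto simp: weight_def)

lemma weight_one: "weight 1 1 = 1\<^sub>m 2"
  by (intro eq_matI) (auto simp: weight_def)

lemma gram_weight:
  assumes "x \<ge> 0" "y \<ge> 0"
  shows "gram 2 (weight (complex_of_real x) (complex_of_real y))"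
proof -
  let ?N = "weight (complex_of_real (sqrt x)) (complex_of_real (sqrt y))"
  have "weight (complex_of_real x) (complex_of_real y) = ?N * mat_adjoint ?N"
    using assms by (simp add: weight_adjoint weight_mult flip: of_real_mult)
  then show ?thesis using gramI[OF weight_carrier] by metis
qed

lemma mat_trace_weight: "mat_trace (weight x y) = x + y"
  by (simp add: mat_trace_def weight_def numeral_2_eq_2)

text \<open>On even triples the signs of \<open>psi\<close> 1, 2, 3 are (-1)^i, (-1)^j, (-1)^k, and
  (-1)^j = (-1)^i (-1)^k. The factor (-1)^i always accompanies \<open>rho_a\<close> and is produced
  by the flip; the common factor (-1)^k for C' = 1 is produced by Z. Hence j does not occur.\<close>

definition sharing_unitary :: "nat \<Rightarrow> nat \<Rightarrow> nat \<Rightarrow> complex mat" where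
  "sharing_unitary d i k = (if i = 0 then 1\<^sub>m (d * d) else flip_op d) \<otimes>\<^sub>m (if k = 0 then weight 1 1 else weight 1 (- 1))"

lemma sharing_unitary_unitary: "unitary_operator (d * d * 2) (sharing_unitary d i k)"
proof -
  let ?F = "if i = 0 then 1\<^sub>m (d * d) else flip_op d"
  let ?Z = "if k = 0 then weight 1 1 else weight 1 (- 1)"
  have F: "?F \<in> carrier_mat (d * d) (d * d)" "mat_adjoint ?F = ?F" "?F * ?F = 1\<^sub>m (d * d)"
    by (simp_all add: flip_op_adjoint flip_op_square one_adjoint)
  have Z: "?Z \<in> carrier_mat 2 2" "mat_adjoint ?Z = ?Z" "?Z * ?Z = 1\<^sub>m 2"
    by (simp_all add: weight_adjoint weight_mult weight_one one_adjoint)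
  show ?thesis
    unfolding unitary_operator_def sharing_unitary_def kron_adjoint F(2) Z(2)
      kron_mult[OF F(1) F(1) Z(1) Z(1)] F(3) Z(3) kron_one
    using carrier_matD[OF F(1)] carrier_matD[OF Z(1)] by (intro conjI carrier_matI) simp_all
qed

text \<open>The block for i = j = k = 0, up to the factor 1/4. Its trace is 2(a1 + a2), which is
  where a1 + a2 = 1/2 enters.\<close>

definition seed_state :: "real \<Rightarrow> real \<Rightarrow> nat \<Rightarrow> complex mat" where
  "seed_state a1 a2 d = (rho_s d + rho_a d) \<otimes>\<^sub>m weight (complex_of_real a1) (complex_of_real a2)"

lemma seed_state_density:
  assumes "a1 \<ge> 0" "a2 \<ge> 0" "a1 + a2 = 1 / 2" "d \<ge> 2"
  shows "density_operator (d * d * 2) (seed_state a1 a2 d)"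
proof -
  let ?D = "weight (complex_of_real a1) (complex_of_real a2)"
  have eq: "seed_state a1 a2 d = rho_s d \<otimes>\<^sub>m ?D + rho_a d \<otimes>\<^sub>m ?D"
    unfolding seed_state_def by (rule kron_add_left[of _ "d * d" "d * d"]) simp_all
  have "psd (d * d * 2) (seed_state a1 a2 d)"
    unfolding eq by (intro psd_add gram_psd gram_kron gram_rho_s gram_rho_a gram_weight assms)
  moreover have "mat_trace (seed_state a1 a2 d) = (1 + 1) * (complex_of_real a1 + complex_of_real a2)"
    unfolding seed_state_def using assms(4)
    by (subst mat_trace_kron[of _ "d * d" _ 2])
      (simp_all add: mat_trace_add[of _ "d * d"] mat_trace_weight mat_trace_rho_s mat_trace_rho_a)
  then have "mat_trace (seed_state a1 a2 d) = complex_of_real (2 * (a1 + a2))" by simp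
  ultimately show ?thesis using assms(3) by (simp add: density_operator_iff)
qed

text \<open>Flip and Z commute with the seed and square to the identity. Hence two equal factors
  cancel, and a single flip turns \<open>rho_s + rho_a\<close> into \<open>rho_s - rho_a\<close>, a
  single Z turns \<open>a2\<close> into \<open>- a2\<close>.\<close>

lemma sharing_conj:
  "sharing_unitary d i k * seed_state a1 a2 d * mat_adjoint (sharing_unitary d i' k') =
     (if (i = 0) = (i' = 0) then rho_s d + rho_a d else rho_s d - rho_a d) \<otimes>\<^sub>m
     (if (k = 0) = (k' = 0) then weight (complex_of_real a1) (complex_of_real a2)
      else weight (complex_of_real a1) (- complex_of_real a2))"
proof -
  let ?F = "\<lambda>i. if i = 0 then 1\<^sub>m (d * d) else flip_op d"
  let ?Z = "\<lambda>k. if k = 0 then weight 1 1 else weight 1 (- 1)"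
  let ?T = "rho_s d + rho_a d" and ?D = "weight (complex_of_real a1) (complex_of_real a2)"
  note F = flip_op_carrier[of d]
  have T: "?T \<in> carrier_mat (d * d) (d * d)" by simp
  have Fi: "?F i \<in> carrier_mat (d * d) (d * d)" "mat_adjoint (?F i) = ?F i" for i :: nat
    by (simp_all add: flip_op_adjoint one_adjoint)
  have Zk: "?Z k \<in> carrier_mat 2 2" "mat_adjoint (?Z k) = ?Z k" for k :: nat
    by (simp_all add: weight_adjoint)
  have FT: "flip_op d * ?T = rho_s d - rho_a d" "?T * flip_op d = rho_s d - rho_a d"
    by (simp_all add: mult_add_distrib_mat[OF F rho_s_carrier rho_a_carrier]
        add_mult_distrib_mat[OF rho_s_carrier rho_a_carrier F] flip_rho_s flip_rho_a
        add_uminus_minus_mat[OF rho_s_carrier rho_a_carrier])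
  have FTF: "(rho_s d - rho_a d) * flip_op d = ?T"
    by (simp add: minus_mult_distrib_mat[OF rho_s_carrier rho_a_carrier F] flip_rho_s flip_rho_a)
      (use carrier_matD[OF rho_s_carrier[of d]] carrier_matD[OF rho_a_carrier[of d]] in \<open>auto intro!: eq_matI\<close>)
  have m: "rho_s d - rho_a d \<in> carrier_mat (d * d) (d * d)" by (rule minus_carrier_mat[OF rho_a_carrier])
  have "sharing_unitary d i k * seed_state a1 a2 d * mat_adjoint (sharing_unitary d i' k') =
    (?F i * ?T * ?F i') \<otimes>\<^sub>m (?Z k * ?D * ?Z k')"
    unfolding sharing_unitary_def seed_state_def kron_adjoint Fi(2) Zk(2)
    by (subst kron_mult[OF Fi(1) T Zk(1) weight_carrier])
      (rule kron_mult[OF mult_carrier_mat[OF Fi(1) T] Fi(1) mult_carrier_mat[OF Zk(1) weight_carrier] Zk(1)])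
  also have "?F i * ?T * ?F i' = (if (i = 0) = (i' = 0) then ?T else rho_s d - rho_a d)"
    using FT FTF right_mult_one_mat[OF T] left_mult_one_mat[OF T] right_mult_one_mat[OF m] by simp
  also have "?Z k * ?D * ?Z k' = (if (k = 0) = (k' = 0) then ?D else weight (complex_of_real a1) (- complex_of_real a2))"
    by (simp add: weight_mult)
  finally show ?thesis .
qed

section \<open>Entries of the state and their comparison with the secret-sharing form\<close>

definition even_index :: "nat \<Rightarrow> bool" where
  "even_index x \<longleftrightarrow> x \<in> {0, 3, 5, 6}"

lemma even_triples_eq: "even_triples = {(0, 0, 0), (0, 1, 1), (1, 0, 1), (1, 1, 0)}"
  by (auto simp: even_triples_def less_2_cases_iff)

lemma ket3_index:
  "x < 8 \<Longrightarrow> ket3 i j k $ x = (if x = i * 4 + j * 2 + k then 1 else 0)"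
  by (auto simp: ket_def unit_vec_def)

lemma ket3_dim [simp]: "dim_vec (ket3 i j k) = 8"
  by (simp add: ket_def)

lemma psi_dim [simp]: "dim_vec (psi l) = 8"
  by (simp add: psi_def)

text \<open>The case distinctions encode the signs (-1)^i, (-1)^j, (-1)^k for l = 1, 2, 3 on the
  indices 0, 3, 5, 6, which are the binary words 000, 011, 101, 110.\<close>

lemma psi_index:
  assumes "x < 8"
  shows "psi l $ x = (if even_index x then
     (if l = 0 then 1 else if l = 1 then (if x < 4 then 1 else -1)
      else if l = 2 then (if even x then if x = 0 then 1 else -1 else if x = 3 then -1 else 1)
      else (if x = 0 \<or> x = 6 then 1 else -1)) / 2 else 0)"
  using assms by (auto simp: psi_def ket3_index even_index_def)

lemma mat_trace_psi: "mat_trace (outer (psi l) (psi l)) = 1"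
proof -
  have "mat_trace (outer (psi l) (psi l)) = (\<Sum>x<8. if even_index x then 1 / 4 else 0)"
    by (auto simp: mat_trace_def outer_def psi_index intro!: sum.cong)
  also have "\<dots> = 1" by (simp add: even_index_def eval_nat_numeral)
  finally show ?thesis .
qed

lemma outer_dims [simp]: "dim_row (outer u v) = dim_vec u" "dim_col (outer u v) = dim_vec v"
  by (simp_all add: outer_def)

lemma qubit_projector:
  "outer (ket [2] [0]) (ket [2] [0]) = weight 1 0" "outer (ket [2] [1]) (ket [2] [1]) = weight 0 1"
  by (auto intro!: eq_matI simp: outer_def ket_def unit_vec_def weight_def numeral_2_eq_2 less_Suc_eq)

text \<open>Four times the block of the state between the key words \<open>x\<close> and
  \<open>x'\<close>, read at shield indices \<open>w\<close>, \<open>w'\<close>. Here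
  \<open>x div 4\<close> and \<open>x mod 2\<close> are the digits of A and C, and
  \<open>w mod 2\<close> is the digit of C'. It is the common normal form of the two descriptions of
  the state.\<close>

definition shield :: "real \<Rightarrow> real \<Rightarrow> nat \<Rightarrow> nat \<Rightarrow> nat \<Rightarrow> nat \<Rightarrow> nat \<Rightarrow> complex" where
  "shield a1 a2 d x x' w w' =
     (if x div 4 = x' div 4 then rho_s d $$ (w div 2, w' div 2) + rho_a d $$ (w div 2, w' div 2)
      else rho_s d $$ (w div 2, w' div 2) - rho_a d $$ (w div 2, w' div 2)) *
     (if w mod 2 = w' mod 2 then if w mod 2 = 0 then complex_of_real a1
        else if x mod 2 = x' mod 2 then complex_of_real a2 else - complex_of_real a2
      else 0)"

lemma rho_carrier: "rho a1 a2 d \<in> carrier_mat (8 * (d * d * 2)) (8 * (d * d * 2))"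
proof -
  have "outer (psi l) (psi l) \<otimes>\<^sub>m rho_s d \<otimes>\<^sub>m weight x y \<in> carrier_mat (8 * (d * d * 2)) (8 * (d * d * 2))"
    "outer (psi l) (psi l) \<otimes>\<^sub>m rho_a d \<otimes>\<^sub>m weight x y \<in> carrier_mat (8 * (d * d * 2)) (8 * (d * d * 2))" for l x y
    using carrier_matD[OF rho_s_carrier[of d]] carrier_matD[OF rho_a_carrier[of d]] carrier_matD[OF weight_carrier[of x y]]
    by (auto simp: outer_def)
  then show ?thesis unfolding rho_def Let_def qubit_projector by (intro add_carrier_mat smult_carrier_mat)
qed

text \<open>For each value of C' the two \<open>psi\<close> differ by the sign (-1)^i only, so their
  projectors add \<open>rho_s\<close> and \<open>rho_a\<close> where the digits of A agree and
  subtract them where they differ.\<close>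

lemma rho_index:
  assumes r: "r < 8 * (d * d * 2)" and c: "c < 8 * (d * d * 2)"
  shows "rho a1 a2 d $$ (r, c) =
    (if even_index (r div (d * d * 2)) \<and> even_index (c div (d * d * 2)) then
       shield a1 a2 d (r div (d * d * 2)) (c div (d * d * 2)) (r mod (d * d * 2)) (c mod (d * d * 2)) / 4
     else 0)"
proof -
  define x x' w w' where d: "x = r div (d * d * 2)" "x' = c div (d * d * 2)" "w = r mod (d * d * 2)" "w' = c mod (d * d * 2)"
  have b: "x < 8" "x' < 8" "w < d * d * 2" "w' < d * d * 2"
    using div_mod_less[OF r] div_mod_less[OF c] by (simp_all add: d)
  note w = div_mod_less[OF b(3)] div_mod_less[OF b(4)]
  define S A where "S = rho_s d $$ (w div 2, w' div 2)" and "A = rho_a d $$ (w div 2, w' div 2)"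
  note dims = carrier_matD[OF rho_s_carrier[of d]] carrier_matD[OF rho_a_carrier[of d]] carrier_matD[OF weight_carrier]
  have term_index: "(outer (psi l) (psi l) \<otimes>\<^sub>m T \<otimes>\<^sub>m weight y z) $$ (r, c) =
      psi l $ x * cnj (psi l $ x') * (T $$ (w div 2, w' div 2) * weight y z $$ (w mod 2, w' mod 2))"
    if "T \<in> carrier_mat (d * d) (d * d)" for l T y z
    using that r c b w carrier_matD[OF weight_carrier[of y z]] 
    by (auto simp: kron_index outer_def d)
  have wt: "weight y z $$ (w mod 2, w' mod 2) = (if w mod 2 = w' mod 2 then if w mod 2 = 0 then y else z else 0)" for y z
    using w by (simp add: weight_def)
  have "rho a1 a2 d $$ (r, c) =
      complex_of_real a1 * (psi 0 $ x * cnj (psi 0 $ x') * (S * weight 1 0 $$ (w mod 2, w' mod 2))) +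
      complex_of_real a1 * (psi 1 $ x * cnj (psi 1 $ x') * (A * weight 1 0 $$ (w mod 2, w' mod 2))) +
      complex_of_real a2 * (psi 2 $ x * cnj (psi 2 $ x') * (A * weight 0 1 $$ (w mod 2, w' mod 2))) +
      complex_of_real a2 * (psi 3 $ x * cnj (psi 3 $ x') * (S * weight 0 1 $$ (w mod 2, w' mod 2)))"
    using r c dims unfolding rho_def Let_def qubit_projector
    by (simp add: term_index S_def A_def)
  also have "\<dots> = (if even_index x \<and> even_index x' then shield a1 a2 d x x' w w' / 4 else 0)"
  proof (cases "even_index x \<and> even_index x'")
    case True
    then have "x \<in> {0, 3, 5, 6}" "x' \<in> {0, 3, 5, 6}" by (simp_all add: even_index_def)
    then show ?thesis unfolding wt shield_def S_def[symmetric] A_def[symmetric]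
      by (elim insertE emptyE) (simp_all add: psi_index even_index_def algebra_simps)
  next
    case False
    then have z: "psi l $ x * cnj (psi l $ x') = 0" for l using b by (auto simp: psi_index)
    show ?thesis unfolding z using False by auto
  qed
  finally show ?thesis by (simp only: d)
qed

lemma rho_density:
  assumes "a1 \<ge> 0" "a2 \<ge> 0" "a1 + a2 = 1 / 2" "d \<ge> 2"
  shows "density_operator (8 * (d * d * 2)) (rho a1 a2 d)"
proof -
  have P: "gram 8 (outer (psi l) (psi l))" for l by (intro gram_outer carrier_vecI) simp
  have W: "gram 2 (weight 1 0)" "gram 2 (weight 0 1)"
    using gram_weight[of 1 0] gram_weight[of 0 1] by simp_all
  have "psd (8 * (d * d * 2)) (rho a1 a2 d)"
    unfolding rho_def Let_def qubit_projector
    by (intro psd_add gram_psd gram_smult gram_kron gram_rho_s gram_rho_a P W assms)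
  moreover have "mat_trace (rho a1 a2 d) = 1"
  proof -
    have C: "outer (psi l) (psi l) \<in> carrier_mat 8 8" for l by (auto simp: outer_def)
    have K: "M \<otimes>\<^sub>m N \<in> carrier_mat (m * n) (m * n)" if "M \<in> carrier_mat m m" "N \<in> carrier_mat n n"
      for M N :: "complex mat" and m n using that by auto
    have tr: "mat_trace (outer (psi l) (psi l) \<otimes>\<^sub>m T \<otimes>\<^sub>m weight x y) = mat_trace T * (x + y)"
      if "T \<in> carrier_mat (d * d) (d * d)" for l T x y
      by (simp add: mat_trace_kron[OF C K[OF that weight_carrier]] mat_trace_kron[OF that weight_carrier]
          mat_trace_psi mat_trace_weight)
    have car: "outer (psi l) (psi l) \<otimes>\<^sub>m T \<otimes>\<^sub>m weight x y \<in> carrier_mat (8 * (d * d * 2)) (8 * (d * d * 2))"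
      if "T \<in> carrier_mat (d * d) (d * d)" for l T x y
      using K[OF C K[OF that weight_carrier]] .
    define n where "n = 8 * (d * d * 2)"
    note car' = car[folded n_def]
    have "mat_trace (rho a1 a2 d) = complex_of_real a1 + complex_of_real a1 + complex_of_real a2 + complex_of_real a2"
      unfolding rho_def Let_def qubit_projector using assms(4)
      by (simp add: mat_trace_add[of _ n] mat_trace_smult[of _ n] car' tr
          mat_trace_rho_s mat_trace_rho_a)
    also have "\<dots> = complex_of_real (2 * (a1 + a2))" by simp
    finally show ?thesis using assms(3) by simp
  qed
  ultimately show ?thesis by (simp add: density_operator_iff)
qed

lemma rho_secret_sharing:
  assumes "a1 \<ge> 0" "a2 \<ge> 0" "a1 + a2 = 1 / 2" "d \<ge> 2"
  shows "secret_sharing_state d d 2 (rho a1 a2 d)"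
proof -
  define n where "n = d * d * 2"
  let ?term = "\<lambda>((i, j, k), (i', j', k')). outer (ket3 i j k) (ket3 i' j' k')
     \<otimes>\<^sub>m (sharing_unitary d i k * seed_state a1 a2 d * mat_adjoint (sharing_unitary d i' k'))"
  have "rho a1 a2 d = (1 / 4) \<cdot>\<^sub>m mat_setsum (8 * n) (8 * n) ?term (even_triples \<times> even_triples)"
  proof (intro eq_matI, goal_cases)
    case (1 r c)
    then have r: "r < 8 * n" "c < 8 * n" by simp_all
    define x x' w w' where xw: "x = r div n" "x' = c div n" "w = r mod n" "w' = c mod n"
    have b: "x < 8" "x' < 8" "w < n" "w' < n"
      using div_mod_less[OF r(1)] div_mod_less[OF r(2)] by (simp_all add: xw)
    note w = div_mod_less[OF b(3)[unfolded n_def]] div_mod_less[OF b(4)[unfolded n_def]]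
    define S A where "S = rho_s d $$ (w div 2, w' div 2)" and "A = rho_a d $$ (w div 2, w' div 2)"
    \<comment> \<open>The entry contributed by the pair of key words with these digits of A and C;
      by \<open>sharing_conj\<close> the digit of B is irrelevant for it.\<close>
    define G where "G i k i' k' = (if (i = 0) = (i' = 0) then S + A else S - A) *
       (if w mod 2 = w' mod 2 then if w mod 2 = 0 then complex_of_real a1
        else if (k = 0) = (k' = 0) then complex_of_real a2 else - complex_of_real a2
      else 0)" for i k i' k' :: nat
    have conj_entry: "(outer (ket3 i j k) (ket3 i' j' k')
     \<otimes>\<^sub>m (sharing_unitary d i k * seed_state a1 a2 d * mat_adjoint (sharing_unitary d i' k'))) $$ (r, c) =
       (if x = i * 4 + j * 2 + k \<and> x' = i' * 4 + j' * 2 + k' then G i k i' k' else 0)" for i j k i' j' k'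
    proof -
      let ?T = "if (i = 0) = (i' = 0) then rho_s d + rho_a d else rho_s d - rho_a d"
      let ?D = "if (k = 0) = (k' = 0) then weight (complex_of_real a1) (complex_of_real a2)
         else weight (complex_of_real a1) (- complex_of_real a2)"
      note cT = carrier_matD[OF rho_s_carrier[of d]] carrier_matD[OF rho_a_carrier[of d]] 
      have dims: "dim_row ?T = d * d" "dim_col ?T = d * d" "dim_row ?D = 2" "dim_col ?D = 2"
        using cT by (simp_all add: weight_def)
      have "(outer (ket3 i j k) (ket3 i' j' k') \<otimes>\<^sub>m ?T \<otimes>\<^sub>m ?D) $$ (r, c) =
         outer (ket3 i j k) (ket3 i' j' k') $$ (x, x') * (?T $$ (w div 2, w' div 2) * ?D $$ (w mod 2, w' mod 2))"
        using r b w unfolding n_def by (simp add: kron_index dims outer_def xw n_def)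
      also have "?T $$ (w div 2, w' div 2) = (if (i = 0) = (i' = 0) then S + A else S - A)"
        using cT w by (cases "i = 0"; cases "i' = 0") (simp_all add: S_def A_def)
      also have "?D $$ (w mod 2, w' mod 2) = (if w mod 2 = w' mod 2 then if w mod 2 = 0 then complex_of_real a1
        else if (k = 0) = (k' = 0) then complex_of_real a2 else - complex_of_real a2 else 0)"
        by (cases "k = 0"; cases "k' = 0") (simp_all add: weight_def)
      also have "outer (ket3 i j k) (ket3 i' j' k') $$ (x, x') = (if x = i * 4 + j * 2 + k \<and> x' = i' * 4 + j' * 2 + k' then 1 else 0)"
        using b by (simp add: outer_def ket3_index)
      finally show ?thesis unfolding sharing_conj G_def by simp
    qed
    have "((1 / 4) \<cdot>\<^sub>m mat_setsum (8 * n) (8 * n) ?term (even_triples \<times> even_triples)) $$ (r, c) =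
      1 / 4 * (\<Sum>t\<in>even_triples. \<Sum>t'\<in>even_triples. ?term (t, t') $$ (r, c))"
      using r by (simp add: sum.cartesian_product) (auto intro!: sum.cong)
    also have "\<dots> = (if even_index x \<and> even_index x' then shield a1 a2 d x x' w w' / 4 else 0)"
    proof (cases "even_index x \<and> even_index x'")
      case True
      then have "x \<in> {0, 3, 5, 6}" "x' \<in> {0, 3, 5, 6}" by (simp_all add: even_index_def)
      then show ?thesis unfolding shield_def S_def[symmetric] A_def[symmetric] even_triples_eq
        by (elim insertE emptyE) (simp_all add: conj_entry even_index_def G_def)
    next
      case False
      have "?term (t, t') $$ (r, c) = 0" if "t \<in> even_triples" "t' \<in> even_triples" for t t'
      proof -
        have "\<exists>i j k. t = (i, j, k) \<and> even_index (i * 4 + j * 2 + k)"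
          "\<exists>i j k. t' = (i, j, k) \<and> even_index (i * 4 + j * 2 + k)"
          using that by (auto simp: even_triples_eq even_index_def)
        then obtain i j k i' j' k' where "t = (i, j, k)" "even_index (i * 4 + j * 2 + k)"
          "t' = (i', j', k')" "even_index (i' * 4 + j' * 2 + k')" by blast
        with False show ?thesis by (auto simp: conj_entry)
      qed
      then show ?thesis using False by (auto simp del: split_paired_All split_paired_Ex)
    qed
    also have "\<dots> = rho a1 a2 d $$ (r, c)"
      unfolding xw n_def by (rule rho_index[OF r[unfolded n_def], symmetric])
    finally show ?case by simp
  qed (use rho_carrier[of a1 a2 d] in \<open>simp_all add: n_def\<close>)
  then show ?thesis unfolding secret_sharing_state_def
    using rho_density[OF assms] seed_state_density[OF assms] sharing_unitary_unitary[of d]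
    by (intro conjI exI[of _ "seed_state a1 a2 d"] exI[of _ "\<lambda>i j k. sharing_unitary d i k"]) (auto simp: n_def)
qed

section \<open>The partial transpose across the split\<close>

lemma digits_of_index_of:
  "list_all2 (<) xs ds \<Longrightarrow> index_of ds xs < prod_list ds \<and> digits_of ds (index_of ds xs) = xs"
proof (induction rule: list_all2_induct)
  case (Cons x xs d ds)
  then show ?case by (simp add: pair_index_less pair_div_mod)
qed simp

text \<open>The second laboratory orders its factors as B, B', C, C' with dimensions 2, d, 2, 2; the
  4 separates CC' from BB'.\<close>

definition key_B :: "nat \<Rightarrow> nat \<Rightarrow> nat" where "key_B d k = k div 4 div d"
definition shield_B :: "nat \<Rightarrow> nat \<Rightarrow> nat" where "shield_B d k = k div 4 mod d"
definition key_C :: "nat \<Rightarrow> nat" where "key_C k = k mod 4 div 2"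
definition shield_C :: "nat \<Rightarrow> nat" where "shield_C k = k mod 4 mod 2"

lemma right_digits:
  assumes "q < d" "C < 2" "z < 2"
  shows "key_B d ((B * d + q) * 4 + (C * 2 + z)) = B" "shield_B d ((B * d + q) * 4 + (C * 2 + z)) = q"
    "key_C ((B * d + q) * 4 + (C * 2 + z)) = C" "shield_C ((B * d + q) * 4 + (C * 2 + z)) = z"
proof -
  have "C * 2 + z < 4" using assms by simp
  note pair_div_mod[OF this, of "B * d + q"]
  then show "key_B d ((B * d + q) * 4 + (C * 2 + z)) = B" "shield_B d ((B * d + q) * 4 + (C * 2 + z)) = q"
    "key_C ((B * d + q) * 4 + (C * 2 + z)) = C" "shield_C ((B * d + q) * 4 + (C * 2 + z)) = z"
    using assms by (simp_all only: key_B_def shield_B_def key_C_def shield_C_def pair_div_mod)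
qed

lemma right_digits_exist:
  fixes k d :: nat
  assumes "k < 2 * d * (2 * 2)"
  obtains B q C z where "k = (B * d + q) * 4 + (C * 2 + z)" "B < 2" "q < d" "C < 2" "z < 2"
proof -
  have k: "k < 2 * d * 4" using assms by simp
  have a: "k div 4 div d < 2" "k div 4 mod d < d" using div_mod_less[OF div_mod_less(1)[OF k]] by auto
  have b: "k mod 4 div 2 < 2" "k mod 4 mod 2 < 2" by auto
  show thesis by (rule that[OF _ a b]) (simp only: div_mult_mod_eq)
qed

lemma left_digits_exist:
  assumes "i < 2 * d"
  obtains A p where "i = A * d + p" "A < 2" "p < (d :: nat)"
  using that[of "i div d" "i mod d"] div_mod_less[OF assms] by (simp add: div_mult_mod_eq)

lemma sum_right_digits:
  fixes f :: "nat \<Rightarrow> 'a::comm_monoid_add"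
  shows "(\<Sum>k<2 * d * (2 * 2). f k) = (\<Sum>B<2. \<Sum>q<d. \<Sum>C<2. \<Sum>z<2. f ((B * d + q) * 4 + (C * 2 + z)))"
  unfolding sum_pair_index by simp

lemma split_state_index:
  assumes "A < 2" "p < d" "B < 2" "q < d" "C < 2" "z < 2" "A' < 2" "p' < d" "B' < 2" "q' < d" "C' < 2" "z' < 2"
  shows "split_state d d 2 M $$ ((A * d + p) * (2 * d * (2 * 2)) + ((B * d + q) * 4 + (C * 2 + z)),
      (A' * d + p') * (2 * d * (2 * 2)) + ((B' * d + q') * 4 + (C' * 2 + z'))) =
    M $$ ((A * 4 + B * 2 + C) * (d * d * 2) + ((p * d + q) * 2 + z), (A' * 4 + B' * 2 + C') * (d * d * 2) + ((p' * d + q') * 2 + z'))"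
proof -
  let ?es = "[2, d, 2, d, 2, 2]"
  have e: "(A * d + p) * (2 * d * (2 * 2)) + ((B * d + q) * 4 + (C * 2 + z)) = index_of ?es [A, p, B, q, C, z]" for A p B q C z
    by (simp add: algebra_simps)
  have l: "list_all2 (<) [A, p, B, q, C, z] ?es" "list_all2 (<) [A', p', B', q', C', z'] ?es"
    using assms by simp_all
  have o: "index_of (map (nth ?es) [0, 2, 4, 1, 3, 5]) (map (nth [A, p, B, q, C, z]) [0, 2, 4, 1, 3, 5]) =
     (A * 4 + B * 2 + C) * (d * d * 2) + ((p * d + q) * 2 + z)" for A p B q C z
    by (simp add: eval_nat_numeral algebra_simps)
  show ?thesis unfolding e split_state_def regroup_def Let_def
    using digits_of_index_of[OF l(1)] digits_of_index_of[OF l(2)] by (simp only: index_mat split o)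
qed

text \<open>The coefficient of the identity in \<open>rho_s + rho_a\<close> and of the flip in
  \<open>rho_s - rho_a\<close>; it equals 2 / (d^2 - 1). The companion \<open>diff_coeff\<close>
  plays the opposite part and equals -2 / (d (d^2 - 1)).\<close>

definition sum_coeff :: "nat \<Rightarrow> real" where
  "sum_coeff d = 1 / ((real d)\<^sup>2 + real d) + 1 / ((real d)\<^sup>2 - real d)"

definition diff_coeff :: "nat \<Rightarrow> real" where
  "diff_coeff d = 1 / ((real d)\<^sup>2 + real d) - 1 / ((real d)\<^sup>2 - real d)"

lemma rho_s_a_index:
  assumes "p < d" "q < d" "p' < d" "q' < d"
  shows "rho_s d $$ (p * d + q, p' * d + q') + rho_a d $$ (p * d + q, p' * d + q') =
      complex_of_real (sum_coeff d) * of_bool (p = p' \<and> q = q') + complex_of_real (diff_coeff d) * of_bool (p = q' \<and> q = p')"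
    "rho_s d $$ (p * d + q, p' * d + q') - rho_a d $$ (p * d + q, p' * d + q') =
      complex_of_real (diff_coeff d) * of_bool (p = p' \<and> q = q') + complex_of_real (sum_coeff d) * of_bool (p = q' \<and> q = p')"
proof -
  have one: "(1\<^sub>m (d * d) :: complex mat) $$ (p * d + q, p' * d + q') = of_bool (p = p' \<and> q = q')"
    using assms by (simp add: one_bip)
  have flip: "flip_op d $$ (p * d + q, p' * d + q') = of_bool (p = q' \<and> q = p')"
    using assms by (simp add: flip_op_bip)
  have s: "rho_s d $$ (p * d + q, p' * d + q') = complex_of_real (1 / ((real d)\<^sup>2 + real d)) * (of_bool (p = p' \<and> q = q') + of_bool (p = q' \<and> q = p'))"
    unfolding rho_s_def real_coefficient_s one[symmetric] flip[symmetric]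
    using assms carrier_matD[OF flip_op_carrier[of d]] pair_index_less[of p d q d] pair_index_less[of p' d q' d]
    by (simp only: index_smult_mat index_add_mat index_one_mat)
  have a: "rho_a d $$ (p * d + q, p' * d + q') = complex_of_real (1 / ((real d)\<^sup>2 - real d)) * (of_bool (p = p' \<and> q = q') - of_bool (p = q' \<and> q = p'))"
    unfolding rho_a_def real_coefficient_a one[symmetric] flip[symmetric]
    using assms carrier_matD[OF flip_op_carrier[of d]] pair_index_less[of p d q d] pair_index_less[of p' d q' d]
    by (simp only: index_smult_mat index_minus_mat index_one_mat)
  show "rho_s d $$ (p * d + q, p' * d + q') + rho_a d $$ (p * d + q, p' * d + q') =
      complex_of_real (sum_coeff d) * of_bool (p = p' \<and> q = q') + complex_of_real (diff_coeff d) * of_bool (p = q' \<and> q = p')"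
    "rho_s d $$ (p * d + q, p' * d + q') - rho_a d $$ (p * d + q, p' * d + q') =
      complex_of_real (diff_coeff d) * of_bool (p = p' \<and> q = q') + complex_of_real (sum_coeff d) * of_bool (p = q' \<and> q = p')"
    unfolding s a sum_coeff_def diff_coeff_def of_real_add of_real_diff by (simp_all only: algebra_simps)
qed

definition key_norm :: "(nat \<Rightarrow> nat \<Rightarrow> nat \<Rightarrow> nat \<Rightarrow> complex) \<Rightarrow> real" where
  "key_norm w = (\<Sum>A<2. \<Sum>B<2. \<Sum>C<2. \<Sum>z<2. (cmod (w A B C z))\<^sup>2)"

text \<open>A product vector: amplitudes \<open>w\<close> on A, B, C together with the classical
  register C', and \<open>V\<close> on A'B'.\<close>

definition key_shield :: "nat \<Rightarrow> (nat \<Rightarrow> nat \<Rightarrow> nat \<Rightarrow> nat \<Rightarrow> complex) \<Rightarrow> (nat \<Rightarrow> nat \<Rightarrow> complex) \<Rightarrow> nat \<Rightarrow> nat \<Rightarrow> complex" where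
  "key_shield d w V i k = w (i div d) (key_B d k) (key_C k) (shield_C k) * V (i mod d) (shield_B d k)"

lemma sqn_key_shield: "sqn (2 * d) (2 * d * (2 * 2)) (key_shield d w V) = key_norm w * sqn d d V"
proof -
  have "sqn (2 * d) (2 * d * (2 * 2)) (key_shield d w V) =
    (\<Sum>A<2. \<Sum>p<d. \<Sum>B<2. \<Sum>q<d. \<Sum>C<2. \<Sum>z<2. (cmod (w A B C z))\<^sup>2 * (cmod (V p q))\<^sup>2)"
    unfolding sqn_def sum_right_digits sum_pair_index
    by (intro sum.cong refl) (simp add: key_shield_def norm_mult power_mult_distrib right_digits del: distrib_right_numeral)
  also have "\<dots> = (\<Sum>A<2. \<Sum>p<d. \<Sum>B<2. \<Sum>q<d. (\<Sum>C<2. \<Sum>z<2. (cmod (w A B C z))\<^sup>2) * (cmod (V p q))\<^sup>2)"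
    by (simp only: sum_distrib_right)
  also have "\<dots> = (\<Sum>A<2. \<Sum>B<2. \<Sum>p<d. \<Sum>q<d. (\<Sum>C<2. \<Sum>z<2. (cmod (w A B C z))\<^sup>2) * (cmod (V p q))\<^sup>2)"
    by (intro sum.cong[OF refl] sum.swap)
  also have "\<dots> = key_norm w * sqn d d V"
    by (simp only: key_norm_def sqn_def sum_distrib_right[symmetric] sum_distrib_left[symmetric])
  finally show ?thesis .
qed

text \<open>The identity on A'B' is its own partial transpose and takes d^2 unit product vectors.
  The flip becomes the projector onto the unnormalised maximally entangled vector, a single vector
  of squared norm d. The right-hand digits in \<open>w\<close> are exchanged for the same reason as
  in \<open>ptsq\<close>.\<close>

lemma ptd_key_shield:
  fixes \<kappa>I \<kappa>F :: real
  shows "ptd (2 * d) (2 * d * (2 * 2)) (key_norm w * (\<bar>\<kappa>I\<bar> * (real d)\<^sup>2 + \<bar>\<kappa>F\<bar> * real d))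
    (bip (2 * d) (2 * d * (2 * 2)) (\<lambda>i k j l.
      (complex_of_real \<kappa>I * of_bool (i mod d = j mod d \<and> shield_B d k = shield_B d l) +
       complex_of_real \<kappa>F * of_bool (i mod d = shield_B d l \<and> shield_B d k = j mod d)) *
      (w (i div d) (key_B d l) (key_C l) (shield_C l) * cnj (w (j div d) (key_B d k) (key_C k) (shield_C k)))))"
proof -
  let ?a = "2 * d" and ?b = "2 * d * (2 * 2)"
  \<comment> \<open>\<open>V t\<close> are the standard basis vectors of A'B', which resolve the
    identity; \<open>V'\<close> below is the maximally entangled vector, which yields the
    flip.\<close>
  define V :: "nat \<times> nat \<Rightarrow> nat \<Rightarrow> nat \<Rightarrow> complex" where "V t p q = of_bool (p = fst t \<and> q = snd t)" for t p q
  define V' :: "nat \<Rightarrow> nat \<Rightarrow> complex" where "V' p q = of_bool (p = q)" for p q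
  let ?S = "{..<d} \<times> {..<d}"
  have nV: "sqn d d (V t) = 1" if "t \<in> ?S" for t
  proof -
    have "sqn d d (V t) = (\<Sum>p<d. \<Sum>q<d. if p = fst t then if q = snd t then 1 else 0 else 0)"
      unfolding sqn_def V_def by (intro sum.cong refl) auto
    also have "\<dots> = (\<Sum>p<d. if p = fst t then \<Sum>q<d. if q = snd t then 1 else 0 else 0)"
      by (intro sum.cong refl) simp
    finally show ?thesis using that by auto
  qed
  have nV': "sqn d d V' = real d"
  proof -
    have "sqn d d V' = (\<Sum>p<d. \<Sum>q<d. if p = q then 1 else 0)"
      unfolding sqn_def V'_def by (intro sum.cong refl) auto
    then show ?thesis by simp
  qed
  have "ptd ?a ?b ((\<Sum>t\<in>?S. \<bar>\<kappa>I\<bar> * sqn ?a ?b (key_shield d w (V t))) + \<bar>\<kappa>F\<bar> * sqn ?a ?b (key_shield d w V'))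
    (mat_setsum (?a * ?b) (?a * ?b) (\<lambda>t. complex_of_real \<kappa>I \<cdot>\<^sub>m ptsq ?a ?b (key_shield d w (V t))) ?S
       + complex_of_real \<kappa>F \<cdot>\<^sub>m ptsq ?a ?b (key_shield d w V'))"
    by (intro ptd_add ptd_setsum ptd_base) simp
  moreover have "(\<Sum>t\<in>?S. \<bar>\<kappa>I\<bar> * sqn ?a ?b (key_shield d w (V t))) + \<bar>\<kappa>F\<bar> * sqn ?a ?b (key_shield d w V') =
     key_norm w * (\<bar>\<kappa>I\<bar> * (real d)\<^sup>2 + \<bar>\<kappa>F\<bar> * real d)"
  proof -
    have "(\<Sum>t\<in>?S. \<bar>\<kappa>I\<bar> * sqn ?a ?b (key_shield d w (V t))) = (\<Sum>t\<in>?S. \<bar>\<kappa>I\<bar> * key_norm w)"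
      by (intro sum.cong refl) (simp only: sqn_key_shield nV mult_1_right)
    then show ?thesis by (simp only: sqn_key_shield nV') (simp add: power2_eq_square algebra_simps)
  qed
  moreover have "mat_setsum (?a * ?b) (?a * ?b) (\<lambda>t. complex_of_real \<kappa>I \<cdot>\<^sub>m ptsq ?a ?b (key_shield d w (V t))) ?S
       + complex_of_real \<kappa>F \<cdot>\<^sub>m ptsq ?a ?b (key_shield d w V') =
    bip ?a ?b (\<lambda>i k j l.
      (complex_of_real \<kappa>I * of_bool (i mod d = j mod d \<and> shield_B d k = shield_B d l) +
       complex_of_real \<kappa>F * of_bool (i mod d = shield_B d l \<and> shield_B d k = j mod d)) *
      (w (i div d) (key_B d l) (key_C l) (shield_C l) * cnj (w (j div d) (key_B d k) (key_C k) (shield_C k))))"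
  proof (rule eq_bipI, goal_cases)
    case 1
    show ?case by (intro add_carrier_mat smult_carrier_mat ptsq_carrier)
  next
    case (2 i k j l)
    define W where "W = w (i div d) (key_B d l) (key_C l) (shield_C l) * cnj (w (j div d) (key_B d k) (key_C k) (shield_C k))"
    have "(\<Sum>t\<in>?S. V t (i mod d) (shield_B d l) * cnj (V t (j mod d) (shield_B d k))) =
      (\<Sum>p<d. \<Sum>q<d. if p = i mod d then if q = shield_B d l then of_bool (i mod d = j mod d \<and> shield_B d k = shield_B d l) else 0 else 0)"
      by (simp only: sum.cartesian_product, intro sum.cong refl) (auto simp: V_def split_beta)
    also have "\<dots> = (\<Sum>p<d. if p = i mod d then \<Sum>q<d. if q = shield_B d l then of_bool (i mod d = j mod d \<and> shield_B d k = shield_B d l) else 0 else 0)"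
      by (intro sum.cong refl) simp
    also have "\<dots> = of_bool (i mod d = j mod d \<and> shield_B d k = shield_B d l)"
    proof -
      have "0 < d" using 2 by (auto intro!: gr0I)
      then show ?thesis by (simp add: shield_B_def)
    qed
    finally have I: "(\<Sum>t\<in>?S. V t (i mod d) (shield_B d l) * cnj (V t (j mod d) (shield_B d k))) =
      of_bool (i mod d = j mod d \<and> shield_B d k = shield_B d l)" .
    have "(\<Sum>t\<in>?S. complex_of_real \<kappa>I * (key_shield d w (V t) i l * cnj (key_shield d w (V t) j k)))
      = complex_of_real \<kappa>I * (\<Sum>t\<in>?S. V t (i mod d) (shield_B d l) * cnj (V t (j mod d) (shield_B d k))) * W"
      by (simp add: key_shield_def W_def sum_distrib_left sum_distrib_right mult_ac)
    moreover have "key_shield d w V' i l * cnj (key_shield d w V' j k) = of_bool (i mod d = shield_B d l \<and> shield_B d k = j mod d) * W"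
      by (auto simp: key_shield_def W_def V'_def)
    ultimately show ?case using 2 pair_index_less[OF 2(1,2)] pair_index_less[OF 2(3,4)] unfolding W_def[symmetric] I
      by (simp add: ptsq_def smult_bip distrib_right mult.assoc)
  qed
  ultimately show ?thesis by (simp only:)
qed

text \<open>The patterns \<open>m = 0, 1\<close> select the diagonal blocks \<open>A = A' = m\<close>; the blocks with \<open>A \<noteq> A'\<close>
  are written as the full pattern \<open>m = 2\<close> minus its diagonal parts \<open>m = 3, 4\<close>, where
  \<open>A = A' = m - 3\<close>. There \<open>B\<close> comes from the other side of the exchange, hence the shift by \<open>1\<close>.\<close>

definition key_pattern :: "nat \<Rightarrow> nat \<Rightarrow> nat \<Rightarrow> nat \<Rightarrow> bool" where
  "key_pattern m A B C \<longleftrightarrow>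
    (if m < 2 then A = m \<and> B = (A + C) mod 2 else (m = 2 \<or> A = m - 3) \<and> B = (A + 1 + C) mod 2)"

text \<open>The sign is that of Z on C' controlled by C. Being a product of one sign per side, it
  fits into the vectors and costs no extra terms.\<close>

definition key_amp :: "nat \<Rightarrow> nat \<Rightarrow> nat \<Rightarrow> nat \<Rightarrow> nat \<Rightarrow> nat \<Rightarrow> complex" where
  "key_amp z0 m A B C z = (if z = z0 \<and> key_pattern m A B C then if z = 1 \<and> C = 1 then -1 else 1 else 0)"

lemma sum_lessThan_2: "(\<Sum>x<2. f x) = f 0 + f (1 :: nat)"
  by (simp add: numeral_2_eq_2)

lemma sum_lessThan_5: "(\<Sum>x<5. f x) = f 0 + f 1 + f 2 + f 3 + f (4 :: nat)"
  by (simp add: eval_nat_numeral)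

text \<open>The minus sign for m = 3, 4 is the subtraction in the polarisation. In
  \<open>coeff_F\<close> the two coefficients change places, as they do between
  \<open>rho_s + rho_a\<close> and \<open>rho_s - rho_a\<close>.\<close>

definition coeff_I :: "real \<Rightarrow> real \<Rightarrow> nat \<Rightarrow> nat \<Rightarrow> nat \<Rightarrow> real" where
  "coeff_I a1 a2 d z0 m = (if z0 = 0 then a1 else a2) / 4 * (if m < 2 then sum_coeff d else if m = 2 then diff_coeff d else - diff_coeff d)"

definition coeff_F :: "real \<Rightarrow> real \<Rightarrow> nat \<Rightarrow> nat \<Rightarrow> nat \<Rightarrow> real" where
  "coeff_F a1 a2 d z0 m = (if z0 = 0 then a1 else a2) / 4 * (if m < 2 then diff_coeff d else if m = 2 then sum_coeff d else - sum_coeff d)"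

lemma key_norm_amp:
  "z0 < 2 \<Longrightarrow> m < 5 \<Longrightarrow> key_norm (key_amp z0 m) = (if m = 2 then 4 else 2)"
proof -
  assume "z0 < 2" "m < 5"
  then have "z0 \<in> {0, 1}" "m \<in> {0, 1, 2, 3, 4}" by auto
  then show ?thesis
    by (elim insertE emptyE) (simp_all add: key_norm_def key_amp_def key_pattern_def sum_lessThan_2)
qed

lemma split_rho_index:
  assumes "A < 2" "p < d" "B < 2" "q < d" "C < 2" "z < 2" "A' < 2" "p' < d" "B' < 2" "q' < d" "C' < 2" "z' < 2"
  shows "split_state d d 2 (rho a1 a2 d) $$ ((A * d + p) * (2 * d * (2 * 2)) + ((B * d + q) * 4 + (C * 2 + z)),
      (A' * d + p') * (2 * d * (2 * 2)) + ((B' * d + q') * 4 + (C' * 2 + z'))) =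
    (if B = (A + C) mod 2 \<and> B' = (A' + C') mod 2 then
      (if A = A' then complex_of_real (sum_coeff d) * of_bool (p = p' \<and> q = q') + complex_of_real (diff_coeff d) * of_bool (p = q' \<and> q = p')
       else complex_of_real (diff_coeff d) * of_bool (p = p' \<and> q = q') + complex_of_real (sum_coeff d) * of_bool (p = q' \<and> q = p')) *
      (if z = z' then if z = 0 then complex_of_real a1
        else if C = C' then complex_of_real a2 else - complex_of_real a2 else 0) / 4 else 0)"
proof -
  have w: "(p * d + q) * 2 + z < d * d * 2" "(p' * d + q') * 2 + z' < d * d * 2"
    by (intro pair_index_less assms)+
  have x: "A * 4 + B * 2 + C < 8" "A' * 4 + B' * 2 + C' < 8" using assms by auto
  have ev: "even_index (A * 4 + B * 2 + C) \<longleftrightarrow> B = (A + C) mod 2" if "A < 2" "B < 2" "C < 2" for A B C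
    using that by (auto simp: less_2_cases_iff even_index_def)
  have dm: "(A * 4 + B * 2 + C) div 4 = A" "(A * 4 + B * 2 + C) mod 2 = C" if "A < 2" "B < 2" "C < 2" for A B C :: nat
    using that by (auto simp: less_2_cases_iff)
  show ?thesis
    unfolding split_state_index[OF assms] rho_index[OF pair_index_less[OF x(1) w(1)] pair_index_less[OF x(2) w(2)]]
      pair_div_mod[OF w(1)] pair_div_mod[OF w(2)] shield_def pair_div_mod[OF assms(6)] pair_div_mod[OF assms(12)]
      ev[OF assms(1,3,5)] ev[OF assms(7,9,11)] dm[OF assms(1,3,5)] dm[OF assms(7,9,11)]
      rho_s_a_index[OF assms(2,4,8,10)] ..
qed

text \<open>For A and A' different only the full pattern m = 2 can match, and its shifted parity
  becomes the correct one because A' = A + 1 modulo 2. For A = A' the term of m = 2 is cancelled by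
  that of m = 3 or 4, which leaves m = A. The 64 cases are simply enumerated.\<close>

lemma key_pattern_sum:
  fixes u v :: complex
  assumes "A < 2" "B < 2" "C < 2" "A' < 2" "B' < 2" "C' < 2"
  shows "(\<Sum>m<5. (if m < 2 then u else if m = 2 then v else - v) * of_bool (key_pattern m A B' C' \<and> key_pattern m A' B C)) =
    of_bool (B = (A + C) mod 2 \<and> B' = (A' + C') mod 2) * (if A = A' then u else v)"
proof -
  have "A \<in> {0, 1}" "A' \<in> {0, 1}" "B \<in> {0, 1}" "B' \<in> {0, 1}" "C \<in> {0, 1}" "C' \<in> {0, 1}" using assms by auto
  then show ?thesis unfolding sum_lessThan_5
    by (elim insertE emptyE) (simp_all add: key_pattern_def)
qed

text \<open>Here \<open>I\<close> and \<open>F\<close> stand for entries of identity and flip on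
  A'B', \<open>x\<close>, \<open>y\<close> for the two weights and \<open>u\<close>,
  \<open>v\<close> for the two coefficients. Since the latter change places with the block,
  \<open>key_pattern_sum\<close> is applied once for \<open>I\<close> and once, with the roles
  reversed, for \<open>F\<close>.\<close>

lemma key_identity:
  fixes I F u v x y :: complex
  assumes "A < 2" "B < 2" "C < 2" "z < 2" "A' < 2" "B' < 2" "C' < 2" "z' < 2"
  shows "(if B = (A + C) mod 2 \<and> B' = (A' + C') mod 2 then
      (if A = A' then u * I + v * F else v * I + u * F) *
      (if z = z' then if z = 0 then x else if C = C' then y else - y else 0) / 4 else 0) =
    (\<Sum>(z0, m)\<in>{..<2} \<times> {..<5}.
      ((if z0 = 0 then x else y) / 4 * (if m < 2 then u else if m = 2 then v else - v) * I +
       (if z0 = 0 then x else y) / 4 * (if m < 2 then v else if m = 2 then u else - u) * F) *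
      (key_amp z0 m A B' C' z' * cnj (key_amp z0 m A' B C z)))"
    (is "?L = ?R")
proof (cases "z = z'")
  case True
  \<comment> \<open>The two signs multiply to -1 exactly if z = 1 and the digits of C differ, which
    is the sign carried by \<open>y\<close> on the left-hand side.\<close>
  define s :: complex where "s = (if z = 1 \<and> C' = 1 then -1 else 1) * (if z = 1 \<and> C = 1 then -1 else 1)"
  define \<alpha> where "\<alpha> = (if z = 0 then x else y) / 4 * s"
  let ?I = "\<lambda>m :: nat. if m < 2 then u else if m = 2 then v else - v"
  let ?F = "\<lambda>m :: nat. if m < 2 then v else if m = 2 then u else - u"
  let ?Q = "\<lambda>m. of_bool (key_pattern m A B' C' \<and> key_pattern m A' B C) :: complex"
  have amp: "key_amp z0 m A B' C' z' * cnj (key_amp z0 m A' B C z) = (if z0 = z then s * ?Q m else 0)" for z0 m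
    using True by (auto simp: key_amp_def s_def)
  have "?R = (\<Sum>(z0, m)\<in>{..<2} \<times> {..<5}. if z0 = z then \<alpha> * ((?I m * I + ?F m * F) * ?Q m) else 0)"
    unfolding amp by (intro sum.cong refl) (simp add: split_beta \<alpha>_def algebra_simps add_divide_distrib)
  also have "\<dots> = (\<Sum>z0<2. \<Sum>m<5. if z0 = z then \<alpha> * ((?I m * I + ?F m * F) * ?Q m) else 0)"
    by (simp only: sum.cartesian_product)
  also have "\<dots> = (\<Sum>z0<2. if z0 = z then \<Sum>m<5. \<alpha> * ((?I m * I + ?F m * F) * ?Q m) else 0)"
    by (intro sum.cong refl) simp
  also have "\<dots> = (\<Sum>m<5. \<alpha> * ((?I m * I + ?F m * F) * ?Q m))"
    using assms(4) by (simp only: sum.delta finite_lessThan lessThan_iff if_True)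
  also have "\<dots> = \<alpha> * (I * (\<Sum>m<5. ?I m * ?Q m) + F * (\<Sum>m<5. ?F m * ?Q m))"
    by (simp only: sum_distrib_left distrib_left sum.distrib[symmetric] distrib_right mult_ac)
  also have "\<dots> = \<alpha> * (of_bool (B = (A + C) mod 2 \<and> B' = (A' + C') mod 2) * (if A = A' then u * I + v * F else v * I + u * F))"
    by (simp only: key_pattern_sum[OF assms(1-3,5-7)]) (simp add: algebra_simps)
  also have "\<dots> = ?L"
  proof -
    have "\<alpha> = (if z = 0 then x else if C = C' then y else - y) / 4"
      using assms(3,4,7) by (auto simp: \<alpha>_def s_def less_2_cases_iff)
    then show ?thesis using True by simp
  qed
  finally show ?thesis by simp
next
  case False
  then have z: "key_amp z0 m A B' C' z' * cnj (key_amp z0 m A' B C z) = 0" for z0 m by (auto simp: key_amp_def)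
  show ?thesis unfolding z using False by simp
qed

text \<open>C' is classical in the state, so its value \<open>z0\<close> splits the decomposition;
  each value takes the five key patterns.\<close>

definition pt_bound :: "real \<Rightarrow> real \<Rightarrow> nat \<Rightarrow> real" where
  "pt_bound a1 a2 d = (\<Sum>(z0, m)\<in>{..<2} \<times> {..<5}.
     key_norm (key_amp z0 m) * (\<bar>coeff_I a1 a2 d z0 m\<bar> * (real d)\<^sup>2 + \<bar>coeff_F a1 a2 d z0 m\<bar> * real d))"

lemma ptd_split_rho:
  "ptd (2 * d) (2 * d * (2 * 2)) (pt_bound a1 a2 d) (split_state d d 2 (rho a1 a2 d))"
proof -
  let ?a = "2 * d" and ?b = "2 * d * (2 * 2)"
  let ?M = "\<lambda>(z0, m). bip ?a ?b (\<lambda>i k j l.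
      (complex_of_real (coeff_I a1 a2 d z0 m) * of_bool (i mod d = j mod d \<and> shield_B d k = shield_B d l) +
       complex_of_real (coeff_F a1 a2 d z0 m) * of_bool (i mod d = shield_B d l \<and> shield_B d k = j mod d)) *
      (key_amp z0 m (i div d) (key_B d l) (key_C l) (shield_C l) * cnj (key_amp z0 m (j div d) (key_B d k) (key_C k) (shield_C k))))"
  have "ptd ?a ?b (pt_bound a1 a2 d) (mat_setsum (?a * ?b) (?a * ?b) ?M ({..<2} \<times> {..<5}))"
    unfolding pt_bound_def by (intro ptd_setsum) (auto simp only: split intro: ptd_key_shield)
  moreover have "mat_setsum (?a * ?b) (?a * ?b) ?M ({..<2} \<times> {..<5}) = split_state d d 2 (rho a1 a2 d)"
  proof -
    have "split_state d d 2 (rho a1 a2 d) = bip ?a ?b (entries ?b (split_state d d 2 (rho a1 a2 d)))"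
      by (rule bip_entries[symmetric]) (simp add: split_state_def regroup_def Let_def mult.assoc)
    moreover have "mat_setsum (?a * ?b) (?a * ?b) ?M ({..<2} \<times> {..<5}) = bip ?a ?b (entries ?b (split_state d d 2 (rho a1 a2 d)))"
    proof (rule eq_bipI, goal_cases)
      case 1
      show ?case by simp
    next
      case (2 i k j l)
      obtain A p where i: "i = A * d + p" "A < 2" "p < d" using left_digits_exist[OF 2(1)] .
      obtain A' p' where j: "j = A' * d + p'" "A' < 2" "p' < d" using left_digits_exist[OF 2(3)] .
      obtain B q C z where k: "k = (B * d + q) * 4 + (C * 2 + z)" "B < 2" "q < d" "C < 2" "z < 2"
        using right_digits_exist[OF 2(2)] .
      obtain B' q' C' z' where l: "l = (B' * d + q') * 4 + (C' * 2 + z')" "B' < 2" "q' < d" "C' < 2" "z' < 2"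
        using right_digits_exist[OF 2(4)] .
      have "mat_setsum (?a * ?b) (?a * ?b) ?M ({..<2} \<times> {..<5}) $$ (i * ?b + k, j * ?b + l) =
        (\<Sum>(z0, m)\<in>{..<2} \<times> {..<5}.
          (complex_of_real (coeff_I a1 a2 d z0 m) * of_bool (i mod d = j mod d \<and> shield_B d k = shield_B d l) +
           complex_of_real (coeff_F a1 a2 d z0 m) * of_bool (i mod d = shield_B d l \<and> shield_B d k = j mod d)) *
          (key_amp z0 m (i div d) (key_B d l) (key_C l) (shield_C l) * cnj (key_amp z0 m (j div d) (key_B d k) (key_C k) (shield_C k))))"
        unfolding mat_setsum_index[OF pair_index_less[OF 2(1,2)] pair_index_less[OF 2(3,4)]]
        by (intro sum.cong refl) (simp only: split_beta bip_pair_index[OF 2])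
      also have "\<dots> = (\<Sum>(z0, m)\<in>{..<2} \<times> {..<5}.
          (complex_of_real (coeff_I a1 a2 d z0 m) * of_bool (p = p' \<and> q = q') +
           complex_of_real (coeff_F a1 a2 d z0 m) * of_bool (p = q' \<and> q = p')) *
          (key_amp z0 m A B' C' z' * cnj (key_amp z0 m A' B C z)))"
        unfolding i(1) j(1) k(1) l(1) right_digits[OF k(3,4,5)] right_digits[OF l(3,4,5)] pair_div_mod[OF i(3)] pair_div_mod[OF j(3)] ..
      also have "\<dots> = (\<Sum>(z0, m)\<in>{..<2} \<times> {..<5}.
        ((if z0 = 0 then complex_of_real a1 else complex_of_real a2) / 4 * (if m < 2 then complex_of_real (sum_coeff d)
            else if m = 2 then complex_of_real (diff_coeff d) else - complex_of_real (diff_coeff d)) * of_bool (p = p' \<and> q = q') +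
         (if z0 = 0 then complex_of_real a1 else complex_of_real a2) / 4 * (if m < 2 then complex_of_real (diff_coeff d)
            else if m = 2 then complex_of_real (sum_coeff d) else - complex_of_real (sum_coeff d)) * of_bool (p = q' \<and> q = p')) *
        (key_amp z0 m A B' C' z' * cnj (key_amp z0 m A' B C z)))"
        by (intro sum.cong refl) (simp only: coeff_I_def coeff_F_def of_real_mult of_real_divide of_real_minus of_real_numeral if_distrib[of complex_of_real])
      also have "\<dots> = entries ?b (split_state d d 2 (rho a1 a2 d)) i k j l"
        unfolding entries_def i(1) j(1) k(1) l(1)
          split_rho_index[OF i(2,3) k(2-5) j(2,3) l(2-5)]
        by (rule key_identity[OF i(2) k(2,4,5) j(2) l(2,4,5), symmetric])
      finally show ?case .
    qed
    ultimately show ?thesis by simp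
  qed
  ultimately show ?thesis by simp
qed

section \<open>The value of the bound, its limit and the normalisation\<close>

lemma pt_bound_eq:
  assumes "a1 \<ge> 0" "a2 \<ge> 0" "a1 + a2 = 1 / 2" "d \<ge> 2"
  shows "pt_bound a1 a2 d = ((real d)\<^sup>2 + 4 * real d + 1) / ((real d)\<^sup>2 - 1)"
proof -
  define D where "D = real d"
  have D: "D \<ge> 2" using assms(4) by (simp add: D_def)
  define u v where "u = 2 / (D\<^sup>2 - 1)" and "v = 2 / (D * (D\<^sup>2 - 1))"
  have D2: "D\<^sup>2 - 1 > 0" using mult_mono[of 2 D 2 D] D by (simp add: power2_eq_square)
  have D3: "D\<^sup>2 + D > 0" "D\<^sup>2 - D > 0" using D by (simp_all add: power2_eq_square add_pos_pos)
  have f: "D\<^sup>2 + D = D * (D + 1)" "D\<^sup>2 - D = D * (D - 1)" "D\<^sup>2 - 1 = (D + 1) * (D - 1)"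
    by (simp_all add: power2_eq_square algebra_simps)
  have nz: "D \<noteq> 0" "D + 1 \<noteq> 0" "D - 1 \<noteq> 0" using D by simp_all
  have s: "sum_coeff d = u" unfolding sum_coeff_def u_def D_def[symmetric] f using nz
    by (simp add: divide_simps)
  have t: "diff_coeff d = - v" unfolding diff_coeff_def v_def D_def[symmetric] f using nz
    by (simp add: divide_simps)
  have pos: "u \<ge> 0" "v \<ge> 0" using D D2 by (simp_all add: u_def v_def)
  \<comment> \<open>Each weight carries a factor 1/4 from the state. The diagonal patterns have key
    norms 2 + 2, giving factor 1; the polarised ones have 4 + 2 + 2, giving factor 2. With a1 + a2 =
    1/2 the two parts are (D^2 + 1) / (D^2 - 1) and 4D / (D^2 - 1).\<close>
  have "pt_bound a1 a2 d = (a1 + a2) * ((u * D\<^sup>2 + v * D) + 2 * (v * D\<^sup>2 + u * D))"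
    unfolding pt_bound_def sum.cartesian_product[symmetric] sum_lessThan_2 sum_lessThan_5 using assms(1,2) pos
    by (simp add: key_norm_amp coeff_I_def coeff_F_def s t D_def[symmetric] abs_mult field_simps)
  also have "\<dots> = (D\<^sup>2 + 4 * D + 1) / (D\<^sup>2 - 1)"
    unfolding assms(3) u_def v_def using nz D2 by (simp add: divide_simps) (simp add: power2_eq_square algebra_simps)
  finally show ?thesis by (simp add: D_def)
qed

lemma pt_bound_limit: "(\<lambda>d. log 2 (((real d)\<^sup>2 + 4 * real d + 1) / ((real d)\<^sup>2 - 1))) \<longlonglongrightarrow> 0"
proof -
  have "(\<lambda>d. (1 + 4 * (1 / real d) + (1 / real d)\<^sup>2) / (1 - (1 / real d)\<^sup>2)) \<longlonglongrightarrow> (1 + 4 * 0 + 0\<^sup>2) / (1 - 0\<^sup>2)"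
    by (intro tendsto_intros lim_1_over_n) simp
  then have "(\<lambda>d. log 2 ((1 + 4 * (1 / real d) + (1 / real d)\<^sup>2) / (1 - (1 / real d)\<^sup>2))) \<longlonglongrightarrow> log 2 1"
    by (intro tendsto_log tendsto_const) simp_all
  moreover have "eventually (\<lambda>d. log 2 ((1 + 4 * (1 / real d) + (1 / real d)\<^sup>2) / (1 - (1 / real d)\<^sup>2)) =
     log 2 (((real d)\<^sup>2 + 4 * real d + 1) / ((real d)\<^sup>2 - 1))) sequentially"
    using eventually_gt_at_top[of 0]
  proof eventually_elim
    case (elim d)
    have "(1 + 4 * (1 / real d) + (1 / real d)\<^sup>2) / (1 - (1 / real d)\<^sup>2) =
      ((real d)\<^sup>2 * (1 + 4 * (1 / real d) + (1 / real d)\<^sup>2)) / ((real d)\<^sup>2 * (1 - (1 / real d)\<^sup>2))"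
      using elim by simp
    also have "(real d)\<^sup>2 * (1 + 4 * (1 / real d) + (1 / real d)\<^sup>2) = (real d)\<^sup>2 + 4 * real d + 1"
      using elim by (simp add: field_simps power2_eq_square)
    also have "(real d)\<^sup>2 * (1 - (1 / real d)\<^sup>2) = (real d)\<^sup>2 - 1"
      using elim by (simp add: field_simps power2_eq_square)
    finally show ?case by simp
  qed
  ultimately show ?thesis by (auto dest: Lim_transform_eventually)
qed

lemma split_rho_carrier: "split_state d d 2 (rho a1 a2 d) \<in> carrier_mat (2 * d * (2 * d * (2 * 2))) (2 * d * (2 * d * (2 * 2)))"
  by (rule ptd_carrier[OF ptd_split_rho])

text \<open>Normalisation after the regrouping, required for the protocol of rate 0. The diagonal
  entries factor into a key sum over A, B, C, C' and a shield sum over A'B'.\<close>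

lemma mat_trace_split_rho:
  assumes "a1 + a2 = 1 / 2" "d \<ge> 2"
  shows "mat_trace (split_state d d 2 (rho a1 a2 d)) = 1"
proof -
  let ?S = "complex_of_real (sum_coeff d)" and ?D = "complex_of_real (diff_coeff d)"
  have "mat_trace (split_state d d 2 (rho a1 a2 d)) = 
    (\<Sum>A<2 :: nat. \<Sum>p<d. \<Sum>B<2. \<Sum>q<d. \<Sum>C<2. \<Sum>z<2 :: nat. (if B = (A + C) mod 2 then if z = 0 then complex_of_real a1 else complex_of_real a2 else 0) *
      ((?S + ?D * of_bool (p = q)) / 4))"
    unfolding mat_trace_entries[OF split_rho_carrier] sum_right_digits entries_def
    unfolding sum_pair_index
    by (intro sum.cong refl) (subst split_rho_index; auto)
  also have "\<dots> = (\<Sum>A<2 :: nat. \<Sum>p<d. \<Sum>B<2. \<Sum>q<d. (\<Sum>C<2. \<Sum>z<2 :: nat. if B = (A + C) mod 2 then if z = 0 then complex_of_real a1 else complex_of_real a2 else 0) *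
      ((?S + ?D * of_bool (p = q)) / 4))"
    by (simp only: sum_distrib_right)
  also have "\<dots> = (\<Sum>A<2 :: nat. \<Sum>B<2. \<Sum>p<d. \<Sum>q<d. (\<Sum>C<2. \<Sum>z<2 :: nat. if B = (A + C) mod 2 then if z = 0 then complex_of_real a1 else complex_of_real a2 else 0) *
      ((?S + ?D * of_bool (p = q)) / 4))"
    by (intro sum.cong[OF refl] sum.swap)
  also have "\<dots> = (\<Sum>A<2 :: nat. \<Sum>B<2. \<Sum>C<2. \<Sum>z<2 :: nat. if B = (A + C) mod 2 then if z = 0 then complex_of_real a1 else complex_of_real a2 else 0) *
     (\<Sum>p<d. \<Sum>q<d. (?S + ?D * of_bool (p = q)) / 4)"
    by (simp only: sum_distrib_right[symmetric] sum_distrib_left[symmetric])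
  also have "(\<Sum>A<2 :: nat. \<Sum>B<2. \<Sum>C<2. \<Sum>z<2 :: nat. if B = (A + C) mod 2 then if z = 0 then complex_of_real a1 else complex_of_real a2 else 0) =
     complex_of_real (4 * (a1 + a2))"
    by (simp add: sum_lessThan_2)
  also have "(\<Sum>p<d. \<Sum>q<d. (?S + ?D * of_bool (p = q)) / 4) = complex_of_real (((real d)\<^sup>2 * sum_coeff d + real d * diff_coeff d) / 4)"
  proof -
    have "(\<Sum>q<d. of_bool (p = q) :: complex) = 1" if "p < d" for p
      using that by (simp add: of_bool_def)
    then show ?thesis
      by (simp add: sum_divide_distrib[symmetric] sum.distrib sum_distrib_left[symmetric] power2_eq_square distrib_left)
  qed
  \<comment> \<open>This is the trace of \<open>rho_s d + rho_a d\<close>, two operators of trace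
    1.\<close>
  also have "(real d)\<^sup>2 * sum_coeff d + real d * diff_coeff d = 2"
  proof -
    have f: "(real d)\<^sup>2 + real d = real d * (real d + 1)" "(real d)\<^sup>2 - real d = real d * (real d - 1)"
      by (simp_all add: power2_eq_square algebra_simps)
    have "real d \<noteq> 0" "real d + 1 \<noteq> 0" "real d - 1 \<noteq> 0" using assms(2) by simp_all
    then show ?thesis unfolding sum_coeff_def diff_coeff_def f
      by (simp add: divide_simps) (simp add: power2_eq_square algebra_simps)
  qed
  finally show ?thesis unfolding assms(1) by simp
qed

theorem mainTheorem6:
  fixes a1 a2 :: real
  assumes "a1 \<ge> 0" and "a2 \<ge> 0" and "a1 + a2 = 1 / 2"
  shows "(\<forall>d\<ge>2. secret_sharing_state d d 2 (rho a1 a2 d)) \<and>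
         (\<lambda>d. split_distillable_entanglement d d 2 (rho a1 a2 d)) \<longlonglongrightarrow> 0 \<and>
         (\<forall>\<epsilon>>0::real. \<exists>dA dB dC \<sigma>. secret_sharing_state dA dB dC \<sigma> \<and>
            split_distillable_entanglement dA dB dC \<sigma> < ereal \<epsilon>)"
proof -
  let ?E = "\<lambda>d. split_distillable_entanglement d d 2 (rho a1 a2 d)"
  let ?c = "\<lambda>d. ((real d)\<^sup>2 + 4 * real d + 1) / ((real d)\<^sup>2 - 1)"
  have sss: "\<forall>d\<ge>2. secret_sharing_state d d 2 (rho a1 a2 d)"
    using rho_secret_sharing[OF assms] by blast
  have lower: "0 \<le> ?E d" if "d \<ge> 2" for d
    unfolding split_distillable_entanglement_def
    by (rule distillable_entanglement_nonneg[OF split_rho_carrier mat_trace_split_rho[OF assms(3) that]])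
  have upper: "?E d \<le> ereal (log 2 (?c d))" if d: "d \<ge> 2" for d
  proof -
    have "(real d)\<^sup>2 > 1" using d by (intro one_less_power) auto
    then have "?c d > 0" by (intro divide_pos_pos add_nonneg_pos) auto
    then show ?thesis unfolding split_distillable_entanglement_def
      using ptd_split_rho[of d a1 a2] unfolding pt_bound_eq[OF assms d]
      by (intro distillable_entanglement_le)
  qed
  have lim: "?E \<longlonglongrightarrow> 0"
  proof (rule tendsto_sandwich)
    show "eventually (\<lambda>d. 0 \<le> ?E d) sequentially"
      using eventually_ge_at_top[of 2] by eventually_elim (rule lower)
    show "eventually (\<lambda>d. ?E d \<le> ereal (log 2 (?c d))) sequentially"
      using eventually_ge_at_top[of 2] by eventually_elim (rule upper)
    show "(\<lambda>d. ereal (log 2 (?c d))) \<longlonglongrightarrow> 0"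
      using pt_bound_limit by (simp add: zero_ereal_def)
  qed simp
  have "\<exists>dA dB dC \<sigma>. secret_sharing_state dA dB dC \<sigma> \<and> split_distillable_entanglement dA dB dC \<sigma> < ereal \<epsilon>"
    if "\<epsilon> > 0" for \<epsilon> :: real
  proof -
    have "eventually (\<lambda>d. ?E d < ereal \<epsilon>) sequentially"
      using that by (intro order_tendstoD(2)[OF lim]) (simp add: zero_ereal_def)
    \<comment> \<open>The limit alone might pick d = 0 or 1, for which \<open>rho_a d\<close> does
      not have trace 1.\<close>
    then have "eventually (\<lambda>d. ?E d < ereal \<epsilon> \<and> d \<ge> 2) sequentially"
      using eventually_ge_at_top by (rule eventually_conj)
    then obtain d where "?E d < ereal \<epsilon>" "d \<ge> 2"
      using eventually_happens'[OF sequentially_bot] by blast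
    then show ?thesis using sss by blast
  qed
  then show ?thesis using sss lim by blast
qed

end
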